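(* Let $n\ge1$ and let $\mathbb{CP}^n$ carry its standard complex structure $j$ and the standard action of $G=SU(n+1)$, $U\cdot[z]=[Uz]$. There is a unique $G$-invariant integrable complexion on the reduced frame bundle of $\mathbb{CP}^n$.
   Context: The reduced frame bundle $P$ of $\mathbb{CP}^n$ is the principal $\mathrm{GL}(n,\mathbb C)$-bundle $\pi:P\to\mathbb{CP}^n$ whose fibre over $x$ consists of the complex-linear isomorphisms $\mathbb C^n\to(T_x\mathbb{CP}^n,j_x)$, with $\mathrm{GL}(n,\mathbb C)$ acting on the right by precomposition; $G$ acts on $P$ on the left by $g\cdot p=L_{g*}\circ p$, where $L_g$ is the action of $g$ on $\mathbb{CP}^n$. Let $H=\mathrm{GL}(n,\mathbb C)$ with its canonical complex structure $i_H$. A complexion on $P$ is an almost complex structure $J$ on $P$ such that $\pi_*\circ J=j\circ\pi_*$ and the action map $(P\times H,J\times i_H)\to(P,J)$ is almost holomorphic (its differential intertwines the almost complex structures). It is $G$-invariant if $J$ commutes with the differential of the action on $P$ of every $g\in G$. It is integrable if its Nijenhuis tensor $N_J(X,Y)=[X,Y]+J[X,JY]+J[JX,Y]-[JX,JY]$ vanishes. *)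

theory Defs
  imports "HOL-Analysis.Analysis"
begin

section \<open>Smooth maps between Euclidean spaces\<close>

text \<open>For open \<open>S\<close> and a finite-dimensional domain: \<open>f\<close> is of class \<open>C^(k+1)\<close> iff it is
  differentiable on \<open>S\<close> and all its directional derivatives are of class \<open>C^k\<close>.\<close>

primrec Ck_on :: "nat \<Rightarrow> 'e::euclidean_space set \<Rightarrow> ('e \<Rightarrow> 'f::real_normed_vector) \<Rightarrow> bool" where
  "Ck_on 0 S f \<longleftrightarrow> continuous_on S f"
| "Ck_on (Suc k) S f \<longleftrightarrow>
     (\<exists>f'. (\<forall>x\<in>S. (f has_derivative f' x) (at x)) \<and> (\<forall>v. Ck_on k S (\<lambda>x. f' x v)))"

definition smooth_on :: "'e::euclidean_space set \<Rightarrow> ('e \<Rightarrow> 'f::real_normed_vector) \<Rightarrow> bool" where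
  "smooth_on S f \<longleftrightarrow> (\<forall>k. Ck_on k S f)"


section \<open>Manifolds given by an atlas\<close>

text \<open>A chart is a domain together with a coordinate map (only its values on the domain matter);
  a manifold is given by a (not necessarily maximal) atlas.\<close>

type_synonym ('a, 'e) chart = "'a set \<times> ('a \<Rightarrow> 'e)"
type_synonym ('a, 'e) atlas = "('a, 'e) chart set"

definition carrier :: "('a, 'e) atlas \<Rightarrow> 'a set" where
  "carrier A = (\<Union>c\<in>A. fst c)"

definition charts_at :: "('a, 'e) atlas \<Rightarrow> 'a \<Rightarrow> ('a, 'e) chart set" where
  "charts_at A x = {c \<in> A. x \<in> fst c}"

definition chart_image :: "('a, 'e) chart \<Rightarrow> 'e set" where
  "chart_image c = snd c ` fst c"

definition chart_inv :: "('a, 'e) chart \<Rightarrow> 'e \<Rightarrow> 'a" where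
  "chart_inv c = inv_into (fst c) (snd c)"

definition transition :: "('a, 'e) chart \<Rightarrow> ('a, 'e) chart \<Rightarrow> 'e \<Rightarrow> 'e" where
  "transition c d = snd d \<circ> chart_inv c"

definition product_atlas :: "('a, 'e) atlas \<Rightarrow> ('b, 'f) atlas \<Rightarrow> ('a \<times> 'b, 'e \<times> 'f) atlas" where
  "product_atlas A B = {(fst c \<times> fst d, map_prod (snd c) (snd d)) | c d. c \<in> A \<and> d \<in> B}"


section \<open>Tangent vectors\<close>

text \<open>A tangent vector at \<open>x\<close> is the family of its coordinate representations: it assigns to each
  chart around \<open>x\<close> a vector of the model space, such that these vectors correspond to each other
  under the derivatives of the transition maps. It is set to \<open>0\<close> on all other charts, so that
  equality of tangent vectors is equality of functions and the vector space operations are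
  pointwise. The base point is not recorded in the vector; it is always passed separately.\<close>

type_synonym ('a, 'e) tvec = "('a, 'e) chart \<Rightarrow> 'e"

definition tangent_space :: "('a, 'e::euclidean_space) atlas \<Rightarrow> 'a \<Rightarrow> ('a, 'e) tvec set" where
  "tangent_space A x =
     {v. (\<forall>c. c \<notin> charts_at A x \<longrightarrow> v c = 0) \<and>
         (\<forall>c\<in>charts_at A x. \<forall>d\<in>charts_at A x.
            v d = frechet_derivative (transition c d) (at (snd c x)) (v c))}"

text \<open>The tangent vector at \<open>x\<close> whose representation in the chart \<open>c\<close> is \<open>\<xi>\<close>.\<close>

definition coord_tvec ::
  "('a, 'e::euclidean_space) atlas \<Rightarrow> ('a, 'e) chart \<Rightarrow> 'a \<Rightarrow> 'e \<Rightarrow> ('a, 'e) tvec" where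
  "coord_tvec A c x \<xi> =
     (\<lambda>d. if d \<in> charts_at A x then frechet_derivative (transition c d) (at (snd c x)) \<xi> else 0)"

text \<open>The differential at \<open>x\<close> of a smooth map \<open>f\<close>, computed in an arbitrary chart \<open>c\<close> around \<open>x\<close>
  (the choice is irrelevant by the chain rule).\<close>

definition tangent_map ::
  "('a, 'e::euclidean_space) atlas \<Rightarrow> ('b, 'f::euclidean_space) atlas \<Rightarrow> ('a \<Rightarrow> 'b) \<Rightarrow>
   'a \<Rightarrow> ('a, 'e) tvec \<Rightarrow> ('b, 'f) tvec" where
  "tangent_map A B f x v =
     (let c = (SOME c. c \<in> charts_at A x) in
      (\<lambda>d. if d \<in> charts_at B (f x)
           then frechet_derivative (snd d \<circ> f \<circ> chart_inv c) (at (snd c x)) (v c) else 0))"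


section \<open>Vector fields and almost complex structures\<close>

type_synonym ('a, 'e) vfield = "'a \<Rightarrow> ('a, 'e) tvec"

definition smooth_vfield :: "('a, 'e::euclidean_space) atlas \<Rightarrow> ('a, 'e) vfield \<Rightarrow> bool" where
  "smooth_vfield A X \<longleftrightarrow>
     (\<forall>x\<in>carrier A. X x \<in> tangent_space A x) \<and>
     (\<forall>c\<in>A. smooth_on (chart_image c) (\<lambda>u. X (chart_inv c u) c))"

text \<open>In coordinates, \<open>[X, Y] = DY(X) - DX(Y)\<close>.\<close>

definition lie_bracket ::
  "('a, 'e::euclidean_space) atlas \<Rightarrow> ('a, 'e) vfield \<Rightarrow> ('a, 'e) vfield \<Rightarrow> ('a, 'e) vfield" where
  "lie_bracket A X Y x =
     (\<lambda>c. if c \<in> charts_at A x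
          then frechet_derivative (\<lambda>u. Y (chart_inv c u) c) (at (snd c x)) (X x c)
             - frechet_derivative (\<lambda>u. X (chart_inv c u) c) (at (snd c x)) (Y x c)
          else 0)"

text \<open>A bundle endomorphism of the tangent bundle. Endomorphisms are taken extensional (hence
  \<open>\<Pi>\<^sub>E\<close> and \<open>restrict\<close> below), so that two of them are equal as functions iff they agree on all
  tangent vectors.\<close>

type_synonym ('a, 'e) endo = "'a \<Rightarrow> ('a, 'e) tvec \<Rightarrow> ('a, 'e) tvec"

definition almost_complex_structure ::
  "('a, 'e::euclidean_space) atlas \<Rightarrow> ('a, 'e) endo \<Rightarrow> bool" where
  "almost_complex_structure A J \<longleftrightarrow>
     J \<in> (\<Pi>\<^sub>E x\<in>carrier A. tangent_space A x \<rightarrow>\<^sub>E tangent_space A x) \<and>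
     (\<forall>x\<in>carrier A. \<forall>v\<in>tangent_space A x. \<forall>w\<in>tangent_space A x.
        J x (\<lambda>c. v c + w c) = (\<lambda>c. J x v c + J x w c)) \<and>
     (\<forall>x\<in>carrier A. \<forall>v\<in>tangent_space A x. \<forall>r::real.
        J x (\<lambda>c. r *\<^sub>R v c) = (\<lambda>c. r *\<^sub>R J x v c)) \<and>
     (\<forall>x\<in>carrier A. \<forall>v\<in>tangent_space A x. J x (J x v) = (\<lambda>c. - v c)) \<and>
     (\<forall>c\<in>A. \<forall>\<xi>. smooth_on (chart_image c)
        (\<lambda>u. J (chart_inv c u) (coord_tvec A c (chart_inv c u) \<xi>) c))"

text \<open>The almost complex structure which in every chart is the constant endomorphism \<open>I\<close> of the
  model space; it makes sense when the derivatives of the transition maps commute with \<open>I\<close>.\<close>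

definition chart_acs ::
  "('a, 'e::euclidean_space) atlas \<Rightarrow> ('e \<Rightarrow> 'e) \<Rightarrow> ('a, 'e) endo" where
  "chart_acs A I = (\<lambda>x\<in>carrier A. \<lambda>v\<in>tangent_space A x. \<lambda>c. I (v c))"

text \<open>The structure \<open>J \<times> K\<close> on a product, under the identification of \<open>T(A \<times> B)\<close> with \<open>TA \<times> TB\<close>
  by the differentials of the two projections.\<close>

definition product_acs ::
  "('a, 'e::euclidean_space) atlas \<Rightarrow> ('a, 'e) endo \<Rightarrow>
   ('b, 'f::euclidean_space) atlas \<Rightarrow> ('b, 'f) endo \<Rightarrow> ('a \<times> 'b, 'e \<times> 'f) endo" where
  "product_acs A J B K =
     (let AB = product_atlas A B in
      (\<lambda>q\<in>carrier AB. \<lambda>v\<in>tangent_space AB q.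
        THE w. w \<in> tangent_space AB q \<and>
          tangent_map AB A fst q w = J (fst q) (tangent_map AB A fst q v) \<and>
          tangent_map AB B snd q w = K (snd q) (tangent_map AB B snd q v)))"

definition almost_holomorphic ::
  "('a, 'e::euclidean_space) atlas \<Rightarrow> ('a, 'e) endo \<Rightarrow>
   ('b, 'f::euclidean_space) atlas \<Rightarrow> ('b, 'f) endo \<Rightarrow> ('a \<Rightarrow> 'b) \<Rightarrow> bool" where
  "almost_holomorphic A J B K f \<longleftrightarrow>
     (\<forall>x\<in>carrier A. \<forall>v\<in>tangent_space A x.
        tangent_map A B f x (J x v) = K (f x) (tangent_map A B f x v))"

definition nijenhuis ::
  "('a, 'e::euclidean_space) atlas \<Rightarrow> ('a, 'e) endo \<Rightarrow>
   ('a, 'e) vfield \<Rightarrow> ('a, 'e) vfield \<Rightarrow> ('a, 'e) vfield" where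
  "nijenhuis A J X Y x =
     (let JX = (\<lambda>y. J y (X y)); JY = (\<lambda>y. J y (Y y)) in
      (\<lambda>c. lie_bracket A X Y x c + J x (lie_bracket A X JY x) c
        + J x (lie_bracket A JX Y x) c - lie_bracket A JX JY x c))"

definition integrable_acs :: "('a, 'e::euclidean_space) atlas \<Rightarrow> ('a, 'e) endo \<Rightarrow> bool" where
  "integrable_acs A J \<longleftrightarrow>
     (\<forall>X Y. smooth_vfield A X \<longrightarrow> smooth_vfield A Y \<longrightarrow>
        (\<forall>x\<in>carrier A. nijenhuis A J X Y x = (\<lambda>c. 0)))"


section \<open>Complex projective space\<close>

text \<open>Here \<open>n = CARD('n) \<ge> 1\<close>, and the \<open>n + 1\<close> homogeneous coordinates are indexed by
  \<open>'n option\<close>. Points are complex lines in \<open>\<complex>\<^bsup>n+1\<^esup>\<close>.\<close>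

type_synonym 'n cp_point = "(complex ^ ('n option)) set"
type_synonym 'n cp_model = "complex ^ 'n"

definition line_of :: "complex ^ ('n::finite option) \<Rightarrow> 'n cp_point" where
  "line_of z = range (\<lambda>a. a *s z)"

definition CP :: "('n::finite) cp_point set" where
  "CP = {line_of z | z. z \<noteq> 0}"

text \<open>The affine chart on \<open>{[z]. z\<^sub>k \<noteq> 0}\<close> consists of the quotients \<open>z\<^sub>j / z\<^sub>k\<close> for \<open>j \<noteq> k\<close>, that is,
  of the remaining coordinates of the point of the line on the hyperplane \<open>z\<^sub>k = 1\<close>.
  The map \<open>other_index k\<close> enumerates the indices \<open>j \<noteq> k\<close> by \<open>'n\<close>.\<close>

definition other_index :: "'n option \<Rightarrow> 'n \<Rightarrow> 'n option" where
  "other_index k i = (if Some i = k then None else Some i)"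

definition cp_chart :: "'n::finite option \<Rightarrow> ('n cp_point, 'n cp_model) chart" where
  "cp_chart k =
     ({L \<in> CP. \<exists>z\<in>L. z $ k \<noteq> 0},
      \<lambda>L. let z = (THE z. z \<in> L \<and> z $ k = 1) in (\<chi> i. z $ other_index k i))"

lemma line_of_in_CP: "z \<noteq> 0 \<Longrightarrow> line_of z \<in> CP"
  by (auto simp: CP_def)

lemma cp_chart_domain:
  fixes z :: "complex ^ ('n::finite option)"
  assumes "z $ k \<noteq> 0"
  shows "line_of z \<in> fst (cp_chart k)"
proof -
  have "z = 1 *s z" by simp
  then have "z \<in> line_of z" unfolding line_of_def by (rule range_eqI)
  moreover have "z \<noteq> 0" using assms by auto
  ultimately show ?thesis using assms line_of_in_CP by (auto simp: cp_chart_def)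
qed

lemma cp_chart_line_of:
  fixes z :: "complex ^ ('n::finite option)"
  assumes "z $ k \<noteq> 0"
  shows "snd (cp_chart k) (line_of z) = (\<chi> i. z $ other_index k i / z $ k)"
proof -
  have "(THE w. w \<in> line_of z \<and> w $ k = 1) = (1 / z $ k) *s z"
  proof (rule the_equality)
    show "(1 / z $ k) *s z \<in> line_of z \<and> ((1 / z $ k) *s z) $ k = 1"
      using assms by (auto simp: line_of_def)
  next
    fix w assume "w \<in> line_of z \<and> w $ k = 1"
    then obtain a where w: "w = a *s z" "w $ k = 1" unfolding line_of_def by blast
    then have "a = 1 / z $ k" using assms by (simp add: field_simps)
    then show "w = (1 / z $ k) *s z" using w by simp
  qed
  then show ?thesis by (simp add: cp_chart_def Let_def)
qed

lemma cp_chart_bij: "bij_betw (snd (cp_chart k)) (fst (cp_chart k)) (UNIV :: 'n::finite cp_model set)"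
proof (rule bij_betwI')
  fix L M assume "L \<in> fst (cp_chart k)" "M \<in> fst (cp_chart k)"
  then have norm: "\<exists>z. z $ k = 1 \<and> K = line_of z" if "K \<in> {L, M}" for K
  proof -
    have "K \<in> fst (cp_chart k)" using that \<open>L \<in> _\<close> \<open>M \<in> _\<close> by auto
    then obtain z w where "K = line_of z" "w \<in> K" "w $ k \<noteq> 0"
      by (auto simp: cp_chart_def CP_def)
    moreover from this obtain a where "w = a *s z" unfolding line_of_def by blast
    ultimately have z: "K = line_of z" "z $ k \<noteq> 0" by simp_all
    have eq: "line_of z = line_of ((1 / z $ k) *s z)"
      unfolding line_of_def
    proof (intro set_eqI iffI; clarify)
      fix b show "b *s z \<in> range (\<lambda>a. a *s ((1 / z $ k) *s z))"
        using z by (intro image_eqI[where x = "b * z $ k"]) auto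
    next
      fix b show "b *s ((1 / z $ k) *s z) \<in> range (\<lambda>a. a *s z)" by auto
    qed
    show ?thesis
    proof (intro exI conjI)
      show "((1 / z $ k) *s z) $ k = 1" using z by simp
      show "K = line_of ((1 / z $ k) *s z)" using z(1) eq by (rule trans)
    qed
  qed
  obtain z w where z: "z $ k = 1" "L = line_of z" and w: "w $ k = 1" "M = line_of w"
    using norm[of L] norm[of M] by auto
  have "z = w" if eq: "\<And>i. z $ other_index k i = w $ other_index k i"
  proof -
    have "z $ j = w $ j" for j
    proof (cases "j = k")
      case False
      then have "other_index k (case j of None \<Rightarrow> the k | Some i \<Rightarrow> i) = j"
        by (auto simp: other_index_def split: option.split)
      then show ?thesis using eq by metis
    qed (simp add: z w)
    then show ?thesis by (simp add: vec_eq_iff)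
  qed
  moreover have "snd (cp_chart k) L = (\<chi> i. z $ other_index k i)"
    "snd (cp_chart k) M = (\<chi> i. w $ other_index k i)"
    using cp_chart_line_of[of z k] cp_chart_line_of[of w k] z w by simp_all
  ultimately have "L = M" if "snd (cp_chart k) L = snd (cp_chart k) M"
    using that z(2) w(2) by (metis vec_lambda_beta)
  then show "(snd (cp_chart k) L = snd (cp_chart k) M) = (L = M)" by blast
next
  fix u :: "'n cp_model"
  define z :: "complex ^ ('n option)" where
    "z = (\<chi> j. if j = k then 1 else u $ (THE i. other_index k i = j))"
  have inj: "other_index k i = other_index k i' \<Longrightarrow> i = i'" for i i'
    by (auto simp: other_index_def split: if_splits)
  have ne: "other_index k i \<noteq> k" for i by (cases k) (auto simp: other_index_def)
  have "(THE i'. other_index k i' = other_index k i) = i" for i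
    by (rule the_equality) (auto dest: inj)
  moreover have k: "z $ k = 1" by (simp add: z_def)
  ultimately have "snd (cp_chart k) (line_of z) = u"
    using cp_chart_line_of[of z k] ne by (simp add: z_def vec_eq_iff)
  then show "\<exists>L\<in>fst (cp_chart k). u = snd (cp_chart k) L"
    using cp_chart_domain[of z k] k by fastforce
qed auto

definition cp_atlas :: "(('n::finite) cp_point, 'n cp_model) atlas" where
  "cp_atlas = range cp_chart"

definition cp_acs :: "(('n::finite) cp_point, 'n cp_model) endo" where
  "cp_acs = chart_acs cp_atlas (\<lambda>u. \<i> *s u)"


section \<open>The groups\<close>

definition SU :: "(complex ^ 'm ^ 'm) set" where
  "SU = {U. transpose (map_matrix cnj U) ** U = mat 1 \<and> det U = 1}"

definition cp_action :: "complex ^ ('n option) ^ ('n option) \<Rightarrow> ('n::finite) cp_point \<Rightarrow> 'n cp_point"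
  where "cp_action U L = (\<lambda>z. U *v z) ` L"

lemma cp_action_line_of: "cp_action U (line_of z) = line_of (U *v z)"
  by (simp add: cp_action_def line_of_def image_image vector_scalar_commute)

definition GL_atlas :: "(complex ^ 'n ^ 'n, complex ^ 'n ^ 'n) atlas" where
  "GL_atlas = {({h. invertible h}, \<lambda>h. h)}"

definition GL_acs :: "(complex ^ 'n ^ 'n, complex ^ 'n ^ 'n) endo" where
  "GL_acs = chart_acs GL_atlas (map_matrix (\<lambda>a. \<i> * a))"


section \<open>The reduced frame bundle\<close>

text \<open>A frame \<open>(x, p)\<close> consists of a point and a linear map defined on \<open>\<complex>\<^sup>n\<close>.\<close>

type_synonym 'n frame = "'n cp_point \<times> (complex ^ 'n \<Rightarrow> ('n cp_point, 'n cp_model) tvec)"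
type_synonym 'n frame_model = "(complex ^ 'n) \<times> (complex ^ 'n ^ 'n)"

definition complex_linear_iso ::
  "('n::finite) cp_point \<Rightarrow> (complex ^ 'n \<Rightarrow> ('n cp_point, 'n cp_model) tvec) \<Rightarrow> bool" where
  "complex_linear_iso x p \<longleftrightarrow>
     bij_betw p UNIV (tangent_space cp_atlas x) \<and>
     (\<forall>u w. p (u + w) = (\<lambda>c. p u c + p w c)) \<and>
     (\<forall>r::real. \<forall>u. p (r *\<^sub>R u) = (\<lambda>c. r *\<^sub>R p u c)) \<and>
     (\<forall>u. p (\<i> *s u) = cp_acs x (p u))"

definition frame_bundle :: "('n::finite) frame set" where
  "frame_bundle = {(x, p). x \<in> CP \<and> complex_linear_iso x p}"

text \<open>The trivialization over a chart \<open>c\<close> of \<open>\<complex>P\<^sup>n\<close> sends \<open>(x, p)\<close> to the coordinates of \<open>x\<close> and the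
  matrix of \<open>p\<close> with respect to the coordinate frame of \<open>c\<close>.\<close>

definition frame_chart ::
  "(('n::finite) cp_point, 'n cp_model) chart \<Rightarrow> ('n frame, 'n frame_model) chart" where
  "frame_chart c =
     ({q \<in> frame_bundle. fst q \<in> fst c},
      \<lambda>(x, p). (snd c x, matrix (\<lambda>u. p u c)))"

definition frame_atlas :: "(('n::finite) frame, 'n frame_model) atlas" where
  "frame_atlas = frame_chart ` cp_atlas"

definition frame_right_action :: "('n::finite) frame \<times> (complex ^ 'n ^ 'n) \<Rightarrow> 'n frame" where
  "frame_right_action = (\<lambda>((x, p), h). (x, \<lambda>u. p (h *v u)))"

definition frame_left_action ::
  "complex ^ ('n option) ^ ('n option) \<Rightarrow> ('n::finite) frame \<Rightarrow> 'n frame" where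
  "frame_left_action U =
     (\<lambda>(x, p). (cp_action U x, \<lambda>u. tangent_map cp_atlas cp_atlas (cp_action U) x (p u)))"


section \<open>Complexions\<close>

text \<open>The bundle projection \<open>\<pi>\<close> is \<open>fst\<close>.\<close>

definition complexion :: "(('n::finite) frame, 'n frame_model) endo \<Rightarrow> bool" where
  "complexion J \<longleftrightarrow>
     almost_complex_structure frame_atlas J \<and>
     (\<forall>q\<in>frame_bundle. \<forall>v\<in>tangent_space frame_atlas q.
        tangent_map frame_atlas cp_atlas fst q (J q v) =
        cp_acs (fst q) (tangent_map frame_atlas cp_atlas fst q v)) \<and>
     almost_holomorphic (product_atlas frame_atlas GL_atlas)
       (product_acs frame_atlas J GL_atlas GL_acs) frame_atlas J frame_right_action"

definition G_invariant :: "(('n::finite) frame, 'n frame_model) endo \<Rightarrow> bool" where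
  "G_invariant J \<longleftrightarrow>
     (\<forall>g\<in>SU. \<forall>q\<in>frame_bundle. \<forall>v\<in>tangent_space frame_atlas q.
        tangent_map frame_atlas frame_atlas (frame_left_action g) q (J q v) =
        J (frame_left_action g q)
          (tangent_map frame_atlas frame_atlas (frame_left_action g) q v))"

end

theory Submission
  imports Defs
begin

text \<open>
  Over an affine chart of projective space a frame is a pair \<open>(u, M)\<close> of an affine coordinate vector
  and an invertible matrix. In such coordinates an invertible linear map \<open>U\<close> of the homogeneous
  coordinates acts on frames by \<open>(u, M) \<mapsto> (F u, DF(u) ** M)\<close>, where \<open>F\<close> is the linear fractional map
  given by \<open>U\<close> (\<open>frame_left_action_frame_of\<close>), and the transition maps of the frame bundle are the
  case \<open>U = 1\<close>. The right action is \<open>((u, M), h) \<mapsto> (u, M ** h)\<close> and the projection is \<open>(u, M) \<mapsto> u\<close>.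
  All these maps have complex-linear derivatives, so multiplication by \<open>\<i>\<close> in the coordinates is an
  invariant complexion \<open>frame_acs\<close>.

  It is integrable because it is constant in every chart: there \<open>D(\<i>X) = \<i> DX\<close>, and the terms of the
  Nijenhuis tensor cancel in pairs (\<open>chart_acs_integrable\<close>). Since an endomorphism field is specified
  only on tangent vectors, this needs that the coordinate formula for the Lie bracket defines a
  tangent vector, which rests on the symmetry of the second derivatives of the transition maps
  (\<open>lie_bracket_tangent\<close>).

  For uniqueness let \<open>J\<close> be an invariant complexion, \<open>J\<^sub>0\<close> the standard one and \<open>v\<close> a tangent vector at a
  frame \<open>q\<close> over \<open>x\<close>. Both structures cover the complex structure of projective space, so
  \<open>J v - J\<^sub>0 v\<close> is vertical; and both agree on vertical vectors, because these are the velocities of the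
  right action (\<open>in_frame_chart_vertical\<close>). The group \<open>SU\<close> contains an element \<open>g\<close> which fixes \<open>x\<close> and
  acts by \<open>-1\<close> on the tangent space at \<open>x\<close> (\<open>point_reflection\<close>), hence \<open>g q = q (-1)\<close>. Let \<open>T\<close> be the sum of
  the differentials at \<open>q\<close> of the left action of \<open>g\<close> and the right action of \<open>-1\<close>. The first one changes
  the sign of the base component and the second one preserves it, so \<open>T v\<close> is vertical, and therefore
  \<open>T (J v) = J (T v) = J\<^sub>0 (T v) = T (J\<^sub>0 v)\<close>. But \<open>T\<close> is \<open>-2\<close> on vertical vectors, so \<open>J v = J\<^sub>0 v\<close>
  (\<open>invariant_complexion_in_frame_chart\<close>).
\<close>


section \<open>Maps with complex-linear derivative and symmetric second derivative\<close>

text \<open>The linear maps \<open>I\<close> and \<open>K\<close> stand for the multiplications by \<open>\<i>\<close> on the two spaces. The second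
  derivative is recorded through the directional derivatives of the first one, and its symmetry is
  part of the property; it is inherited by sums, products and quotients, so that rational maps
  have it without a theorem on mixed partial derivatives.\<close>

definition C2_derivs ::
  "('e::euclidean_space \<Rightarrow> 'e) \<Rightarrow> ('f::euclidean_space \<Rightarrow> 'f) \<Rightarrow> 'e set \<Rightarrow> ('e \<Rightarrow> 'f) \<Rightarrow>
   ('e \<Rightarrow> 'e \<Rightarrow> 'f) \<Rightarrow> ('e \<Rightarrow> 'e \<Rightarrow> 'e \<Rightarrow> 'f) \<Rightarrow> bool" where
  "C2_derivs I K S f f' f'' \<longleftrightarrow>
     (\<forall>x\<in>S. (f has_derivative f' x) (at x) \<and> (\<forall>v. f' x (I v) = K (f' x v)) \<and>
        (\<forall>v. ((\<lambda>y. f' y v) has_derivative f'' x v) (at x)) \<and> (\<forall>v w. f'' x v w = f'' x w v))"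

definition complex_C2_on ::
  "('e::euclidean_space \<Rightarrow> 'e) \<Rightarrow> ('f::euclidean_space \<Rightarrow> 'f) \<Rightarrow> 'e set \<Rightarrow> ('e \<Rightarrow> 'f) \<Rightarrow> bool" where
  "complex_C2_on I K S f \<longleftrightarrow> (\<exists>f' f''. C2_derivs I K S f f' f'')"

lemma complex_C2_onI:
  assumes "\<And>x. x \<in> S \<Longrightarrow> (f has_derivative f' x) (at x)"
    and "\<And>x v. x \<in> S \<Longrightarrow> f' x (I v) = K (f' x v)"
    and "\<And>x v. x \<in> S \<Longrightarrow> ((\<lambda>y. f' y v) has_derivative f'' x v) (at x)"
    and "\<And>x v w. x \<in> S \<Longrightarrow> f'' x v w = f'' x w v"
  shows "complex_C2_on I K S f"
proof -
  have "C2_derivs I K S f f' f''" using assms unfolding C2_derivs_def by simp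
  then show ?thesis unfolding complex_C2_on_def by (intro exI)
qed

lemma C2_derivsD:
  assumes "C2_derivs I K S f f' f''"
  shows "\<And>x. x \<in> S \<Longrightarrow> (f has_derivative f' x) (at x)"
    and "\<And>x v. x \<in> S \<Longrightarrow> f' x (I v) = K (f' x v)"
    and "\<And>x v. x \<in> S \<Longrightarrow> ((\<lambda>y. f' y v) has_derivative f'' x v) (at x)"
    and "\<And>x v w. x \<in> S \<Longrightarrow> f'' x v w = f'' x w v"
  using assms unfolding C2_derivs_def by simp_all

lemma complex_C2_on_subset: "complex_C2_on I K S f \<Longrightarrow> T \<subseteq> S \<Longrightarrow> complex_C2_on I K T f"
  unfolding complex_C2_on_def C2_derivs_def by blast

lemma complex_C2_on_cong:
  assumes "complex_C2_on I K S f" "open S" "\<And>x. x \<in> S \<Longrightarrow> f x = g x"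
  shows "complex_C2_on I K S g"
proof -
  obtain f' f'' where f0: "C2_derivs I K S f f' f''"
    using assms(1) unfolding complex_C2_on_def by (elim exE)
  note f = C2_derivsD[OF f0]
  show ?thesis
  proof (rule complex_C2_onI[of _ _ f' _ _ f''])
    show "(g has_derivative f' x) (at x)" if "x \<in> S" for x
      using has_derivative_transform_within_open[OF f(1) assms(2)] that assms(3) by blast
  qed (use f in auto)
qed

lemma complex_C2_on_const:
  assumes "K 0 = 0"
  shows "complex_C2_on I K S (\<lambda>x. a)"
  by (rule complex_C2_onI[of _ _ "\<lambda>x v. 0" _ _ "\<lambda>x v w. 0"]) (use assms in auto)

lemma complex_C2_on_linear:
  assumes "linear f" "\<And>v. f (I v) = K (f v)"
  shows "complex_C2_on I K S f"
proof (rule complex_C2_onI[of _ _ "\<lambda>x. f" _ _ "\<lambda>x v w. 0"])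
  show "(f has_derivative f) (at x)" for x
    using assms(1) by (simp add: linear_conv_bounded_linear bounded_linear_imp_has_derivative)
qed (use assms in auto)

lemma complex_C2_on_compose_linear_left:
  assumes f_C2: "complex_C2_on I K S f" and L: "linear L" "\<And>v. L (K v) = M (L v)"
  shows "complex_C2_on I M S (\<lambda>x. L (f x))"
proof -
  obtain f' f'' where f0: "C2_derivs I K S f f' f''"
    using f_C2 unfolding complex_C2_on_def by (elim exE)
  note f = C2_derivsD[OF f0]
  have L': "bounded_linear L" using L(1) by (simp add: linear_conv_bounded_linear)
  show ?thesis
    by (rule complex_C2_onI[of _ _ "\<lambda>x v. L (f' x v)" _ _ "\<lambda>x v w. L (f'' x v w)"])
      (use f L(2) in \<open>auto intro: bounded_linear.has_derivative[OF L']\<close>)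
qed

lemma complex_C2_on_compose_linear_right:
  assumes f_C2: "complex_C2_on I K S f" and L: "linear L" "\<And>v. L (M v) = I (L v)"
  shows "complex_C2_on M K (L -` S) (\<lambda>x. f (L x))"
proof -
  obtain f' f'' where f0: "C2_derivs I K S f f' f''"
    using f_C2 unfolding complex_C2_on_def by (elim exE)
  note f = C2_derivsD[OF f0]
  have L': "(L has_derivative L) (at x)" for x
    using L(1) by (simp add: linear_conv_bounded_linear bounded_linear_imp_has_derivative)
  show ?thesis
  proof (rule complex_C2_onI[of _ _ "\<lambda>x v. f' (L x) (L v)" _ _ "\<lambda>x v w. f'' (L x) (L v) (L w)"])
    show "((\<lambda>x. f (L x)) has_derivative (\<lambda>v. f' (L x) (L v))) (at x)" if "x \<in> L -` S" for x
      using has_derivative_compose[OF L' f(1)] that by simp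
    show "((\<lambda>y. f' (L y) (L v)) has_derivative (\<lambda>w. f'' (L x) (L v) (L w))) (at x)"
      if "x \<in> L -` S" for x v
      using has_derivative_compose[OF L' f(3)] that by simp
  qed (use f L(2) in auto)
qed

lemma complex_C2_on_add:
  assumes f_C2: "complex_C2_on I K S f" and g_C2: "complex_C2_on I K S g" and K: "linear K"
  shows "complex_C2_on I K S (\<lambda>x. f x + g x)"
proof -
  obtain f' f'' where f0: "C2_derivs I K S f f' f''"
    using f_C2 unfolding complex_C2_on_def by (elim exE)
  note f = C2_derivsD[OF f0]
  obtain g' g'' where g0: "C2_derivs I K S g g' g''"
    using g_C2 unfolding complex_C2_on_def by (elim exE)
  note g = C2_derivsD[OF g0]
  show ?thesis
    by (rule complex_C2_onI[of _ _ "\<lambda>x v. f' x v + g' x v" _ _ "\<lambda>x v w. f'' x v w + g'' x v w"])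
      (use f g in \<open>auto simp: linear_add[OF K] intro!: has_derivative_add\<close>)
qed

lemma complex_C2_on_sum:
  assumes "\<And>i. i \<in> F \<Longrightarrow> complex_C2_on I K S (f i)" and K: "linear K"
  shows "complex_C2_on I K S (\<lambda>x. \<Sum>i\<in>F. f i x)"
proof (cases "finite F")
  case True
  then show ?thesis using assms(1)
    by (induction F)
      (auto intro: complex_C2_on_const complex_C2_on_add K simp: linear_0[OF K])
qed (auto intro: complex_C2_on_const simp: linear_0[OF K])

lemma complex_C2_on_mult:
  fixes f g :: "'e::euclidean_space \<Rightarrow> complex"
  assumes f_C2: "complex_C2_on I ((*) \<i>) S f" and g_C2: "complex_C2_on I ((*) \<i>) S g"
  shows "complex_C2_on I ((*) \<i>) S (\<lambda>x. f x * g x)"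
proof -
  obtain f' f'' where f0: "C2_derivs I ((*) \<i>) S f f' f''"
    using f_C2 unfolding complex_C2_on_def by (elim exE)
  note f = C2_derivsD[OF f0]
  obtain g' g'' where g0: "C2_derivs I ((*) \<i>) S g g' g''"
    using g_C2 unfolding complex_C2_on_def by (elim exE)
  note g = C2_derivsD[OF g0]
  show ?thesis
  proof (rule complex_C2_onI[of _ _ "\<lambda>x v. f x * g' x v + f' x v * g x" _ _
        "\<lambda>x v w. (f x * g'' x v w + f' x w * g' x v) + (f' x v * g' x w + f'' x v w * g x)"])
    fix x assume x: "x \<in> S"
    show "((\<lambda>x. f x * g x) has_derivative (\<lambda>v. f x * g' x v + f' x v * g x)) (at x)"
      by (rule has_derivative_mult[OF f(1)[OF x] g(1)[OF x]])
    show "((\<lambda>y. f y * g' y v + f' y v * g y) has_derivative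
        (\<lambda>w. (f x * g'' x v w + f' x w * g' x v) + (f' x v * g' x w + f'' x v w * g x))) (at x)" for v
      by (intro has_derivative_add has_derivative_mult f g x)
    show "(f x * g'' x v w + f' x w * g' x v) + (f' x v * g' x w + f'' x v w * g x) =
      (f x * g'' x w v + f' x v * g' x w) + (f' x w * g' x v + f'' x w v * g x)" for v w
      using f(4)[OF x, of v w] g(4)[OF x, of v w] by simp
  qed (use f g in \<open>auto simp: algebra_simps\<close>)
qed

lemma complex_C2_on_inverse:
  fixes f :: "'e::euclidean_space \<Rightarrow> complex"
  assumes f_C2: "complex_C2_on I ((*) \<i>) S f" and nz: "\<And>x. x \<in> S \<Longrightarrow> f x \<noteq> 0"
  shows "complex_C2_on I ((*) \<i>) S (\<lambda>x. inverse (f x))"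
proof -
  obtain f' f'' where f0: "C2_derivs I ((*) \<i>) S f f' f''"
    using f_C2 unfolding complex_C2_on_def by (elim exE)
  note f = C2_derivsD[OF f0]
  have inv: "((\<lambda>x. inverse (f x)) has_derivative
      (\<lambda>v. - (inverse (f x) * f' x v * inverse (f x)))) (at x)" if "x \<in> S" for x
    by (rule Deriv.has_derivative_inverse[OF nz[OF that] f(1)[OF that]])
  show ?thesis
  proof (rule complex_C2_onI[of _ _ "\<lambda>x v. - (inverse (f x) * f' x v * inverse (f x))" _ _
        "\<lambda>x v w. - (inverse (f x) * f' x v * - (inverse (f x) * f' x w * inverse (f x)) +
           (inverse (f x) * f'' x v w + - (inverse (f x) * f' x w * inverse (f x)) * f' x v) * inverse (f x))"])
    fix x assume x: "x \<in> S"
    show "((\<lambda>y. - (inverse (f y) * f' y v * inverse (f y))) has_derivative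
      (\<lambda>w. - (inverse (f x) * f' x v * - (inverse (f x) * f' x w * inverse (f x)) +
           (inverse (f x) * f'' x v w + - (inverse (f x) * f' x w * inverse (f x)) * f' x v) * inverse (f x)))) (at x)" for v
      by (intro has_derivative_minus has_derivative_mult inv f x)
    show "- (inverse (f x) * f' x v * - (inverse (f x) * f' x w * inverse (f x)) +
           (inverse (f x) * f'' x v w + - (inverse (f x) * f' x w * inverse (f x)) * f' x v) * inverse (f x)) =
       - (inverse (f x) * f' x w * - (inverse (f x) * f' x v * inverse (f x)) +
           (inverse (f x) * f'' x w v + - (inverse (f x) * f' x v * inverse (f x)) * f' x w) * inverse (f x))"
      for v w
      using f(4)[OF x, of v w] by (simp add: algebra_simps)
  qed (use f inv in \<open>auto simp: algebra_simps\<close>)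
qed

lemma complex_C2_on_divide:
  fixes f g :: "'e::euclidean_space \<Rightarrow> complex"
  assumes "complex_C2_on I ((*) \<i>) S f" "complex_C2_on I ((*) \<i>) S g" "\<And>x. x \<in> S \<Longrightarrow> g x \<noteq> 0"
  shows "complex_C2_on I ((*) \<i>) S (\<lambda>x. f x / g x)"
  unfolding divide_inverse using assms by (intro complex_C2_on_mult complex_C2_on_inverse) auto

lemma complex_C2_imp_has_derivative:
  assumes "complex_C2_on I K S f" "x \<in> S"
  obtains f' where "(f has_derivative f') (at x)" "\<And>v. f' (I v) = K (f' v)"
proof -
  obtain f' f'' where "C2_derivs I K S f f' f''"
    using assms(1) unfolding complex_C2_on_def by (elim exE)
  from C2_derivsD(1,2)[OF this assms(2)] show thesis by (rule that)
qed

lemma complex_C2_on_imp_continuous_on: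
  assumes "complex_C2_on I K S f"
  shows "continuous_on S f"
proof -
  obtain f' f'' where f: "C2_derivs I K S f f' f''"
    using assms unfolding complex_C2_on_def by (elim exE)
  show ?thesis
    by (rule continuous_at_imp_continuous_on) (blast intro: has_derivative_continuous C2_derivsD(1)[OF f])
qed

lemma complex_C2_on_Pair:
  assumes f: "complex_C2_on I K S f" and g: "complex_C2_on I L S g"
    and lin: "linear K" "linear L"
  shows "complex_C2_on I (map_prod K L) S (\<lambda>x. (f x, g x))"
proof -
  have "complex_C2_on I (map_prod K L) S (\<lambda>w. (f w, 0))"
    by (rule complex_C2_on_compose_linear_left[OF f, of "\<lambda>z. (z, 0)"])
      (auto intro!: linearI simp: linear_0 lin)
  moreover have "complex_C2_on I (map_prod K L) S (\<lambda>w. (0, g w))"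
    by (rule complex_C2_on_compose_linear_left[OF g, of "\<lambda>z. (0, z)"])
      (auto intro!: linearI simp: linear_0 lin)
  moreover have "linear (map_prod K L)"
    using lin by (auto intro!: linearI simp: linear_add linear_scale)
  ultimately have "complex_C2_on I (map_prod K L) S (\<lambda>w. (f w, 0) + (0, g w))"
    by (rule complex_C2_on_add)
  then show ?thesis by simp
qed

lemma complex_C2_on_map_prod:
  assumes f: "complex_C2_on I I' S f" and g: "complex_C2_on K K' T g"
    and lin: "linear I'" "linear K'"
  shows "complex_C2_on (map_prod I K) (map_prod I' K') (S \<times> T) (map_prod f g)"
proof -
  have "complex_C2_on (map_prod I K) I' (fst -` S) (\<lambda>w. f (fst w))"
    by (rule complex_C2_on_compose_linear_right[OF f linear_fst]) simp
  then have 1: "complex_C2_on (map_prod I K) I' (S \<times> T) (\<lambda>w. f (fst w))"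
    by (rule complex_C2_on_subset) auto
  have "complex_C2_on (map_prod I K) K' (snd -` T) (\<lambda>w. g (snd w))"
    by (rule complex_C2_on_compose_linear_right[OF g linear_snd]) simp
  then have 2: "complex_C2_on (map_prod I K) K' (S \<times> T) (\<lambda>w. g (snd w))"
    by (rule complex_C2_on_subset) auto
  have "map_prod f g = (\<lambda>w. (f (fst w), g (snd w)))" by (simp add: fun_eq_iff)
  then show ?thesis using complex_C2_on_Pair[OF 1 2 lin] by simp
qed

lemma linear_vector_scalar_mult: "linear ((*s) (a::complex))"
  by (rule linearI) (simp_all add: vec_eq_iff algebra_simps)

lemma linear_map_matrix_mult: "linear (map_matrix ((*) (a::complex)))"
  by (rule linearI) (simp_all add: vec_eq_iff algebra_simps)

lemma vec_sum_axis: "f = (\<Sum>i\<in>UNIV. axis i (f $ i))"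
  for f :: "('a::comm_monoid_add) ^ 'n"
  by (simp add: vec_eq_iff axis_def if_distrib sum.delta cong: if_cong)

lemma complex_C2_on_vec:
  fixes f :: "'e::euclidean_space \<Rightarrow> complex ^ 'n"
  assumes "\<And>i. complex_C2_on I ((*) \<i>) S (\<lambda>x. f x $ i)"
  shows "complex_C2_on I ((*s) \<i>) S f"
proof -
  have "complex_C2_on I ((*s) \<i>) S (\<lambda>x. axis i (f x $ i))" for i
    by (rule complex_C2_on_compose_linear_left[OF assms])
      (auto intro!: linearI simp: vec_eq_iff axis_def)
  then have "complex_C2_on I ((*s) \<i>) S (\<lambda>x. \<Sum>i\<in>UNIV. axis i (f x $ i))"
    by (intro complex_C2_on_sum linear_vector_scalar_mult)
  then show ?thesis by (simp only: vec_sum_axis[symmetric])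
qed

lemma complex_C2_on_matrix:
  fixes f :: "'e::euclidean_space \<Rightarrow> complex ^ 'n ^ 'm"
  assumes "\<And>i j. complex_C2_on I ((*) \<i>) S (\<lambda>x. f x $ i $ j)"
  shows "complex_C2_on I (map_matrix ((*) \<i>)) S f"
proof -
  have "complex_C2_on I (map_matrix ((*) \<i>)) S (\<lambda>x. axis i (f x $ i))" for i
    by (rule complex_C2_on_compose_linear_left[OF complex_C2_on_vec[OF assms]])
      (auto intro!: linearI simp: vec_eq_iff axis_def)
  then have "complex_C2_on I (map_matrix ((*) \<i>)) S (\<lambda>x. \<Sum>i\<in>UNIV. axis i (f x $ i))"
    by (intro complex_C2_on_sum linear_map_matrix_mult)
  then show ?thesis by (simp only: vec_sum_axis[symmetric])
qed

text \<open>The chain rule for a derivative that is evaluated at a moving vector, as needed for differentiating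
  the transformation law of vector fields. Since only the directional derivatives of \<open>f'\<close> are given, the
  vector is expanded in a basis.\<close>

lemma C2_derivs_apply_field:
  fixes f :: "'e::euclidean_space \<Rightarrow> 'f::euclidean_space" and g :: "'e \<Rightarrow> 'e"
  assumes f0: "C2_derivs I K S f f' f''" and S: "open S" "x \<in> S"
    and g: "(g has_derivative g') (at x)"
  shows "((\<lambda>y. f' y (g y)) has_derivative (\<lambda>w. f'' x (g x) w + f' x (g' w))) (at x)"
proof -
  note f = C2_derivsD[OF f0]
  have lin: "linear (f' y)" if "y \<in> S" for y
    using f(1)[OF that] by (rule has_derivative_linear)
  have lin2: "linear (f'' x w)" for w
    using f(3)[OF S(2)] by (rule has_derivative_linear)
  have expand: "h v = (\<Sum>b\<in>Basis. (v \<bullet> b) *\<^sub>R h b)" if "linear h" for h :: "'e \<Rightarrow> 'f" and v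
  proof -
    have "h v = h (\<Sum>b\<in>Basis. (v \<bullet> b) *\<^sub>R b)" by (simp add: euclidean_representation)
    then show ?thesis by (simp only: linear_sum[OF that] linear_scale[OF that])
  qed
  have "((\<lambda>y. \<Sum>b\<in>Basis. (g y \<bullet> b) *\<^sub>R f' y b) has_derivative
      (\<lambda>w. \<Sum>b\<in>Basis. (g x \<bullet> b) *\<^sub>R f'' x b w + (g' w \<bullet> b) *\<^sub>R f' x b)) (at x)"
    by (intro has_derivative_sum has_derivative_scaleR f(3)[OF S(2)]
        has_derivative_inner_left g)
  moreover have "(\<Sum>b\<in>Basis. (g x \<bullet> b) *\<^sub>R f'' x b w + (g' w \<bullet> b) *\<^sub>R f' x b)
      = f'' x (g x) w + f' x (g' w)" for w
    using expand[OF lin2[of w], of "g x"] expand[OF lin[OF S(2)], of "g' w"]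
    by (simp add: sum.distrib f(4)[OF S(2), of _ w])
  ultimately have "((\<lambda>y. \<Sum>b\<in>Basis. (g y \<bullet> b) *\<^sub>R f' y b) has_derivative
      (\<lambda>w. f'' x (g x) w + f' x (g' w))) (at x)" by simp
  then show ?thesis
    by (rule has_derivative_transform_within_open[OF _ S]) (simp add: expand[OF lin, symmetric])
qed

section \<open>Manifolds with holomorphic transition maps\<close>

lemma chart_inv_in_domain: "u \<in> chart_image c \<Longrightarrow> chart_inv c u \<in> fst c"
  unfolding chart_image_def chart_inv_def by (rule inv_into_into)

lemma chart_chart_inv: "u \<in> chart_image c \<Longrightarrow> snd c (chart_inv c u) = u"
  unfolding chart_image_def chart_inv_def by (rule f_inv_into_f)

lemma charts_atD: "c \<in> charts_at A x \<Longrightarrow> c \<in> A" "c \<in> charts_at A x \<Longrightarrow> x \<in> fst c"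
  by (simp_all add: charts_at_def)

lemma carrierE:
  assumes "x \<in> carrier A"
  obtains c where "c \<in> charts_at A x"
  using assms unfolding carrier_def charts_at_def by blast

lemma charts_at_carrier: "c \<in> charts_at A x \<Longrightarrow> x \<in> carrier A"
  unfolding carrier_def charts_at_def by blast

lemma Ck_on_constant_on:
  fixes f :: "'e::euclidean_space \<Rightarrow> 'f::real_normed_vector"
  assumes "open S" "\<And>x. x \<in> S \<Longrightarrow> f x = a"
  shows "Ck_on k S f"
  using assms(2)
proof (induction k arbitrary: f a)
  case 0
  then show ?case by (simp cong: continuous_on_cong)
next
  case (Suc k)
  have "(f has_derivative (\<lambda>v. 0)) (at x)" if "x \<in> S" for x
    by (rule has_derivative_transform_within_open[OF has_derivative_const assms(1) that])
      (simp add: Suc.prems)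
  moreover have "Ck_on k S (\<lambda>x. 0 :: 'f)" by (rule Suc.IH[where a = 0]) simp
  ultimately show ?case by (auto intro!: exI[of _ "\<lambda>x v. 0"])
qed

lemma smooth_on_differentiable:
  assumes "smooth_on S f" "x \<in> S"
  shows "f differentiable (at x)"
proof -
  have "Ck_on (Suc 0) S f" using assms(1) unfolding smooth_on_def by blast
  then show ?thesis using assms(2) unfolding differentiable_def by auto
qed

text \<open>The endomorphism \<open>I\<close> of the model space is a complex structure, and the transition maps are
  holomorphic with respect to it; this is what makes \<open>chart_acs A I\<close> meaningful.\<close>

locale complex_atlas =
  fixes I :: "'e::euclidean_space \<Rightarrow> 'e" and A :: "('a, 'e) atlas"
  assumes linear_I: "linear I"
    and I_I: "I (I v) = - v"
    and inj_chart: "c \<in> A \<Longrightarrow> inj_on (snd c) (fst c)"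
    and open_overlap: "c \<in> A \<Longrightarrow> d \<in> A \<Longrightarrow> open (snd c ` (fst c \<inter> fst d))"
    and transition_C2: "c \<in> A \<Longrightarrow> d \<in> A \<Longrightarrow>
      complex_C2_on I I (snd c ` (fst c \<inter> fst d)) (transition c d)"
begin

lemma chart_inv_chart: "c \<in> A \<Longrightarrow> x \<in> fst c \<Longrightarrow> chart_inv c (snd c x) = x"
  unfolding chart_inv_def using inj_chart by (simp add: inv_into_f_f)

lemma transition_chart: "c \<in> A \<Longrightarrow> x \<in> fst c \<Longrightarrow> transition c d (snd c x) = snd d x"
  by (simp add: transition_def chart_inv_chart)

lemma open_chart_image: "c \<in> A \<Longrightarrow> open (chart_image c)"
  using open_overlap[of c c] by (simp add: chart_image_def)

lemma transition_has_derivative: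
  assumes "c \<in> charts_at A x" "d \<in> charts_at A x"
  shows "(transition c d has_derivative frechet_derivative (transition c d) (at (snd c x)))
    (at (snd c x))"
    and "frechet_derivative (transition c d) (at (snd c x)) (I v)
      = I (frechet_derivative (transition c d) (at (snd c x)) v)"
proof -
  have cd: "c \<in> A" "d \<in> A" "snd c x \<in> snd c ` (fst c \<inter> fst d)"
    using assms by (auto simp: charts_at_def)
  obtain f' f'' where "C2_derivs I I (snd c ` (fst c \<inter> fst d)) (transition c d) f' f''"
    using transition_C2[OF cd(1,2)] unfolding complex_C2_on_def by (elim exE)
  note f = C2_derivsD[OF this]
  have eq: "f' (snd c x) = frechet_derivative (transition c d) (at (snd c x))"
    by (rule frechet_derivative_at[OF f(1)[OF cd(3)]])
  show "(transition c d has_derivative frechet_derivative (transition c d) (at (snd c x)))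
    (at (snd c x))" using f(1)[OF cd(3)] eq by simp
  show "frechet_derivative (transition c d) (at (snd c x)) (I v)
      = I (frechet_derivative (transition c d) (at (snd c x)) v)"
    using f(2)[OF cd(3), of v] eq by simp
qed

lemma linear_transition_derivative:
  "c \<in> charts_at A x \<Longrightarrow> d \<in> charts_at A x \<Longrightarrow>
    linear (frechet_derivative (transition c d) (at (snd c x)))"
  using transition_has_derivative(1) by (rule has_derivative_linear)

text \<open>The cocycle condition of the tangent bundle: a vector that is given in one chart extends to a
  compatible family.\<close>

lemma transition_derivative_chain:
  assumes c: "c \<in> charts_at A x" and d: "d \<in> charts_at A x" and e: "e \<in> charts_at A x"
  shows "frechet_derivative (transition d e) (at (snd d x))
      (frechet_derivative (transition c d) (at (snd c x)) v)
    = frechet_derivative (transition c e) (at (snd c x)) v"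
proof -
  have in_A: "c \<in> A" "d \<in> A" "x \<in> fst c" "x \<in> fst d" using c d by (auto simp: charts_at_def)
  have "(transition d e has_derivative frechet_derivative (transition d e) (at (snd d x)))
      (at (transition c d (snd c x)))"
    using transition_has_derivative(1)[OF d e] by (simp add: transition_chart in_A)
  from has_derivative_compose[OF transition_has_derivative(1)[OF c d] this]
  have "((\<lambda>u. transition d e (transition c d u)) has_derivative
      (\<lambda>v. frechet_derivative (transition d e) (at (snd d x))
      (frechet_derivative (transition c d) (at (snd c x)) v))) (at (snd c x))" .
  then have "(transition c e has_derivative
      (\<lambda>v. frechet_derivative (transition d e) (at (snd d x))
      (frechet_derivative (transition c d) (at (snd c x)) v))) (at (snd c x))"
    by (rule has_derivative_transform_within_open[OF _ open_overlap[OF in_A(1,2)]])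
      (use in_A in \<open>auto simp: transition_chart\<close>)
  from frechet_derivative_at[OF this] show ?thesis by (simp add: fun_eq_iff)
qed

lemma transition_derivative_refl:
  assumes c: "c \<in> charts_at A x"
  shows "frechet_derivative (transition c c) (at (snd c x)) v = v"
proof -
  have in_A: "c \<in> A" "x \<in> fst c" using c by (auto simp: charts_at_def)
  have "(transition c c has_derivative (\<lambda>v. v)) (at (snd c x))"
    by (rule has_derivative_transform_within_open[OF has_derivative_ident open_overlap[of c c]])
      (use in_A in \<open>auto simp: transition_chart\<close>)
  from frechet_derivative_at[OF this] show ?thesis by (simp add: fun_eq_iff)
qed

lemma tangent_transition:
  "v \<in> tangent_space A x \<Longrightarrow> c \<in> charts_at A x \<Longrightarrow> d \<in> charts_at A x \<Longrightarrow>
    v d = frechet_derivative (transition c d) (at (snd c x)) (v c)"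
  unfolding tangent_space_def by blast

lemma tangent_outside: "v \<in> tangent_space A x \<Longrightarrow> c \<notin> charts_at A x \<Longrightarrow> v c = 0"
  unfolding tangent_space_def by blast

text \<open>The main means of proving equations between tangent vectors: one chart suffices.\<close>

lemma tangent_eqI:
  assumes "v \<in> tangent_space A x" "w \<in> tangent_space A x" "c \<in> charts_at A x" "v c = w c"
  shows "v = w"
proof
  fix d
  show "v d = w d"
  proof (cases "d \<in> charts_at A x")
    case True
    then show ?thesis
      using assms tangent_transition[of v x c d] tangent_transition[of w x c d] by metis
  qed (use assms in \<open>simp add: tangent_outside\<close>)
qed

lemma coord_tvec_tangent:
  assumes c: "c \<in> charts_at A x"
  shows "coord_tvec A c x \<xi> \<in> tangent_space A x"
  unfolding tangent_space_def coord_tvec_def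
  using transition_derivative_chain[OF c] by simp

lemma coord_tvec_same: "c \<in> charts_at A x \<Longrightarrow> coord_tvec A c x \<xi> c = \<xi>"
  by (simp add: coord_tvec_def transition_derivative_refl)

lemma coord_tvec_eqI:
  "v \<in> tangent_space A x \<Longrightarrow> c \<in> charts_at A x \<Longrightarrow> v c = \<xi> \<Longrightarrow> v = coord_tvec A c x \<xi>"
  by (rule tangent_eqI[of _ x _ c]) (simp_all add: coord_tvec_tangent coord_tvec_same)

lemma tangentI:
  assumes "\<And>c. c \<notin> charts_at A x \<Longrightarrow> v c = 0"
    and "\<And>c d. c \<in> charts_at A x \<Longrightarrow> d \<in> charts_at A x \<Longrightarrow>
      v d = frechet_derivative (transition c d) (at (snd c x)) (v c)"
  shows "v \<in> tangent_space A x"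
  unfolding tangent_space_def using assms by blast

lemma tangent_apply_linear:
  assumes L: "linear L" and v: "v \<in> tangent_space A x"
    and comm: "\<And>c d w. c \<in> charts_at A x \<Longrightarrow> d \<in> charts_at A x \<Longrightarrow>
      frechet_derivative (transition c d) (at (snd c x)) (L w)
      = L (frechet_derivative (transition c d) (at (snd c x)) w)"
  shows "(\<lambda>c. L (v c)) \<in> tangent_space A x"
proof (rule tangentI)
  fix c d assume cd: "c \<in> charts_at A x" "d \<in> charts_at A x"
  show "L (v d) = frechet_derivative (transition c d) (at (snd c x)) (L (v c))"
    unfolding comm[OF cd] tangent_transition[OF v cd] ..
qed (simp add: tangent_outside[OF v] linear_0[OF L])

lemma tangent_I: "v \<in> tangent_space A x \<Longrightarrow> (\<lambda>c. I (v c)) \<in> tangent_space A x"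
  by (rule tangent_apply_linear[OF linear_I _ transition_has_derivative(2)])

lemma tangent_scale: "v \<in> tangent_space A x \<Longrightarrow> (\<lambda>c. r *\<^sub>R v c) \<in> tangent_space A x"
  by (rule tangent_apply_linear[OF linear_scale_self _ linear_scale[OF linear_transition_derivative]])

lemma tangent_add:
  assumes v: "v \<in> tangent_space A x" and w: "w \<in> tangent_space A x"
  shows "(\<lambda>c. v c + w c) \<in> tangent_space A x"
proof (rule tangentI)
  fix c d assume cd: "c \<in> charts_at A x" "d \<in> charts_at A x"
  show "v d + w d = frechet_derivative (transition c d) (at (snd c x)) (v c + w c)"
    unfolding linear_add[OF linear_transition_derivative[OF cd]]
      tangent_transition[OF v cd] tangent_transition[OF w cd] ..
qed (simp add: tangent_outside[OF v] tangent_outside[OF w])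

lemma chart_acs_apply:
  "x \<in> carrier A \<Longrightarrow> v \<in> tangent_space A x \<Longrightarrow> chart_acs A I x v = (\<lambda>c. I (v c))"
  by (simp add: chart_acs_def)

text \<open>In every chart the structure is the constant \<open>I\<close>, so each axiom reduces to the corresponding
  property of \<open>I\<close>; the smoothness condition concerns a constant function.\<close>

lemma chart_acs_almost_complex: "almost_complex_structure A (chart_acs A I)"
  unfolding almost_complex_structure_def
proof (intro conjI ballI allI)
  show "chart_acs A I \<in> (\<Pi>\<^sub>E x\<in>carrier A. tangent_space A x \<rightarrow>\<^sub>E tangent_space A x)"
    by (auto simp: chart_acs_def tangent_I)
next
  fix x v w assume "x \<in> carrier A" "v \<in> tangent_space A x" "w \<in> tangent_space A x"
  then show "chart_acs A I x (\<lambda>c. v c + w c) = (\<lambda>c. chart_acs A I x v c + chart_acs A I x w c)"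
    by (simp add: chart_acs_apply tangent_add linear_add[OF linear_I])
next
  fix x v and r :: real assume "x \<in> carrier A" "v \<in> tangent_space A x"
  then show "chart_acs A I x (\<lambda>c. r *\<^sub>R v c) = (\<lambda>c. r *\<^sub>R chart_acs A I x v c)"
    by (simp add: chart_acs_apply tangent_scale linear_scale[OF linear_I])
next
  fix x v assume "x \<in> carrier A" "v \<in> tangent_space A x"
  then show "chart_acs A I x (chart_acs A I x v) = (\<lambda>c. - v c)"
    by (simp add: chart_acs_apply tangent_I I_I)
next
  fix c \<xi> assume c: "c \<in> A"
  have "chart_acs A I (chart_inv c u) (coord_tvec A c (chart_inv c u) \<xi>) c = I \<xi>"
    if "u \<in> chart_image c" for u
  proof -
    have "c \<in> charts_at A (chart_inv c u)"
      using chart_inv_in_domain[OF that] c by (simp add: charts_at_def)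
    then show ?thesis
      by (simp add: chart_acs_apply charts_at_carrier coord_tvec_tangent coord_tvec_same)
  qed
  then show "smooth_on (chart_image c)
      (\<lambda>u. chart_acs A I (chart_inv c u) (coord_tvec A c (chart_inv c u) \<xi>) c)"
    unfolding smooth_on_def by (intro allI Ck_on_constant_on[OF open_chart_image[OF c]])
qed

text \<open>The Nijenhuis tensor of \<open>J = chart_acs A I\<close> uses only the first derivatives of \<open>X\<close> and \<open>J X\<close>, and
  differentiability passes from \<open>X\<close> to \<open>J X\<close> more directly than smoothness.\<close>

definition differentiable_vfield :: "('a, 'e) vfield \<Rightarrow> bool" where
  "differentiable_vfield X \<longleftrightarrow> (\<forall>x\<in>carrier A. X x \<in> tangent_space A x) \<and>
     (\<forall>c\<in>A. \<forall>u\<in>chart_image c. (\<lambda>u. X (chart_inv c u) c) differentiable (at u))"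

lemma smooth_vfield_differentiable: "smooth_vfield A X \<Longrightarrow> differentiable_vfield X"
  unfolding smooth_vfield_def differentiable_vfield_def by (blast intro: smooth_on_differentiable)

lemma differentiable_vfield_at:
  assumes "differentiable_vfield X" "c \<in> charts_at A x"
  shows "((\<lambda>u. X (chart_inv c u) c) has_derivative
     frechet_derivative (\<lambda>u. X (chart_inv c u) c) (at (snd c x))) (at (snd c x))"
  using assms unfolding differentiable_vfield_def charts_at_def chart_image_def
  by (simp add: frechet_derivative_works[symmetric])

text \<open>The derivative of the transformation law \<open>X\<^sub>d \<circ> f = f' X\<^sub>c\<close>, where \<open>f\<close> is the transition map from \<open>c\<close> to \<open>d\<close>.\<close>

lemma vfield_transition_derivative:
  assumes X: "differentiable_vfield X" and cd: "c \<in> charts_at A x" "d \<in> charts_at A x"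
    and f0: "C2_derivs I I (snd c ` (fst c \<inter> fst d)) (transition c d) f' f''"
  shows "frechet_derivative (\<lambda>u. X (chart_inv d u) d) (at (snd d x)) (f' (snd c x) v)
    = f'' (snd c x) (X x c) v
      + f' (snd c x) (frechet_derivative (\<lambda>u. X (chart_inv c u) c) (at (snd c x)) v)"
proof -
  let ?S = "snd c ` (fst c \<inter> fst d)"
  have in_A: "c \<in> A" "d \<in> A" "x \<in> fst c" "x \<in> fst d" using cd by (auto simp: charts_at_def)
  have S: "open ?S" "snd c x \<in> ?S" using open_overlap in_A by auto
  note f = C2_derivsD[OF f0]
  have "X (chart_inv d (transition c d u)) d = f' u (X (chart_inv c u) c)" if u: "u \<in> ?S" for u
  proof -
    obtain y where y: "u = snd c y" "y \<in> fst c" "y \<in> fst d" using u by blast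
    have at: "c \<in> charts_at A y" "d \<in> charts_at A y" using in_A y by (simp_all add: charts_at_def)
    then have "X y \<in> tangent_space A y"
      using X charts_at_carrier[OF at(1)] unfolding differentiable_vfield_def by blast
    from tangent_transition[OF this at] have "X y d = f' u (X y c)"
      unfolding y(1)[symmetric] frechet_derivative_at[OF f(1)[OF u], symmetric] .
    then show ?thesis
      by (simp only: y(1) transition_chart[OF in_A(1) y(2)] chart_inv_chart in_A y(2,3))
  qed
  note push = this
  have "((\<lambda>u. f' u (X (chart_inv c u) c)) has_derivative
      (\<lambda>v. f'' (snd c x) (X (chart_inv c (snd c x)) c) v
      + f' (snd c x) (frechet_derivative (\<lambda>u. X (chart_inv c u) c) (at (snd c x)) v))) (at (snd c x))"
    by (rule C2_derivs_apply_field[OF f0 S differentiable_vfield_at[OF X cd(1)]])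
  then have "((\<lambda>u. X (chart_inv d (transition c d u)) d) has_derivative
      (\<lambda>v. f'' (snd c x) (X (chart_inv c (snd c x)) c) v
      + f' (snd c x) (frechet_derivative (\<lambda>u. X (chart_inv c u) c) (at (snd c x)) v))) (at (snd c x))"
    by (rule has_derivative_transform_within_open[OF _ S]) (simp add: push)
  moreover have "((\<lambda>u. X (chart_inv d (transition c d u)) d) has_derivative
      (\<lambda>v. frechet_derivative (\<lambda>u. X (chart_inv d u) d) (at (snd d x)) (f' (snd c x) v))) (at (snd c x))"
    by (rule has_derivative_compose[OF f(1)[OF S(2)]])
      (use differentiable_vfield_at[OF X cd(2)] in_A in \<open>simp add: transition_chart\<close>)
  ultimately have "(\<lambda>v. frechet_derivative (\<lambda>u. X (chart_inv d u) d) (at (snd d x)) (f' (snd c x) v))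
     = (\<lambda>v. f'' (snd c x) (X (chart_inv c (snd c x)) c) v
      + f' (snd c x) (frechet_derivative (\<lambda>u. X (chart_inv c u) c) (at (snd c x)) v))"
    by (rule has_derivative_unique[rotated])
  from fun_cong[OF this, of v] show ?thesis by (simp only: chart_inv_chart in_A)
qed

text \<open>By \<open>vfield_transition_derivative\<close> the coordinate brackets in two charts differ by
  \<open>f'' Y X - f'' X Y\<close>, apart from the factor \<open>f'\<close> by which a tangent vector has to transform.\<close>

lemma lie_bracket_tangent:
  assumes X: "differentiable_vfield X" and Y: "differentiable_vfield Y" and x: "x \<in> carrier A"
  shows "lie_bracket A X Y x \<in> tangent_space A x"
proof -
  have "lie_bracket A X Y x d = frechet_derivative (transition c d) (at (snd c x)) (lie_bracket A X Y x c)"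
    if cd: "c \<in> charts_at A x" "d \<in> charts_at A x" for c d
  proof -
    have in_A: "c \<in> A" "d \<in> A" "x \<in> fst c" "x \<in> fst d" using cd by (auto simp: charts_at_def)
    have S: "snd c x \<in> snd c ` (fst c \<inter> fst d)" using in_A by auto
    obtain f' f'' where f0: "C2_derivs I I (snd c ` (fst c \<inter> fst d)) (transition c d) f' f''"
      using transition_C2[OF in_A(1,2)] unfolding complex_C2_on_def by (elim exE)
    note f = C2_derivsD[OF f0]
    have f': "frechet_derivative (transition c d) (at (snd c x)) = f' (snd c x)"
      by (rule frechet_derivative_at[OF f(1)[OF S], symmetric])
    have Xx: "X x \<in> tangent_space A x" "Y x \<in> tangent_space A x"
      using X Y x unfolding differentiable_vfield_def by blast+
    show ?thesis
      using cd vfield_transition_derivative[OF X cd f0, of "Y x c"]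
        vfield_transition_derivative[OF Y cd f0, of "X x c"]
        f(4)[OF S, of "X x c" "Y x c"]
        tangent_transition[OF Xx(1) cd] tangent_transition[OF Xx(2) cd]
        linear_diff[OF has_derivative_linear[OF f(1)[OF S]]]
      by (simp add: lie_bracket_def f')
  qed
  then show ?thesis by (intro tangentI) (simp add: lie_bracket_def)
qed

lemma chart_acs_vfield:
  assumes X: "differentiable_vfield X"
  shows "differentiable_vfield (\<lambda>y. chart_acs A I y (X y))"
    and "c \<in> charts_at A x \<Longrightarrow>
      frechet_derivative (\<lambda>u. chart_acs A I (chart_inv c u) (X (chart_inv c u)) c) (at (snd c x)) v
      = I (frechet_derivative (\<lambda>u. X (chart_inv c u) c) (at (snd c x)) v)"
proof -
  have X_tangent: "X x \<in> tangent_space A x" if "x \<in> carrier A" for x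
    using X that unfolding differentiable_vfield_def by blast
  have der: "((\<lambda>u. chart_acs A I (chart_inv c u) (X (chart_inv c u)) c) has_derivative
     (\<lambda>v. I (frechet_derivative (\<lambda>u. X (chart_inv c u) c) (at (snd c x)) v))) (at (snd c x))"
    if c: "c \<in> charts_at A x" for c x
  proof (rule has_derivative_transform_within_open)
    show "((\<lambda>u. I (X (chart_inv c u) c)) has_derivative
     (\<lambda>v. I (frechet_derivative (\<lambda>u. X (chart_inv c u) c) (at (snd c x)) v))) (at (snd c x))"
      by (rule bounded_linear.has_derivative[OF _ differentiable_vfield_at[OF X c]])
        (use linear_I linear_conv_bounded_linear in blast)
    show "open (chart_image c)" "snd c x \<in> chart_image c"
      using c open_chart_image by (auto simp: charts_at_def chart_image_def)
    fix u assume "u \<in> chart_image c"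
    then have "c \<in> charts_at A (chart_inv c u)"
      using chart_inv_in_domain c by (simp add: charts_at_def)
    then have "chart_inv c u \<in> carrier A" by (rule charts_at_carrier)
    then show "I (X (chart_inv c u) c) = chart_acs A I (chart_inv c u) (X (chart_inv c u)) c"
      by (simp add: chart_acs_apply X_tangent)
  qed
  show "frechet_derivative (\<lambda>u. chart_acs A I (chart_inv c u) (X (chart_inv c u)) c) (at (snd c x)) v
      = I (frechet_derivative (\<lambda>u. X (chart_inv c u) c) (at (snd c x)) v)"
    if "c \<in> charts_at A x"
    by (rule fun_cong[OF frechet_derivative_at[OF der[OF that], symmetric]])
  have "(\<lambda>u. chart_acs A I (chart_inv c u) (X (chart_inv c u)) c) differentiable (at u)"
    if "c \<in> A" "u \<in> chart_image c" for c u
  proof -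
    have "c \<in> charts_at A (chart_inv c u)"
      using chart_inv_in_domain that by (simp add: charts_at_def)
    from der[OF this] show ?thesis
      unfolding chart_chart_inv[OF that(2)] differentiable_def by blast
  qed
  then show "differentiable_vfield (\<lambda>y. chart_acs A I y (X y))"
    unfolding differentiable_vfield_def by (simp add: chart_acs_apply X_tangent tangent_I)
qed

text \<open>As \<open>D(I X) = I DX\<close>, all eight terms of the Nijenhuis tensor are of the form \<open>DX(Y)\<close>, \<open>DY(X)\<close>,
  \<open>I DX(I Y)\<close> or \<open>I DY(I X)\<close> up to sign, each of them twice with opposite signs.\<close>

lemma chart_acs_integrable: "integrable_acs A (chart_acs A I)"
  unfolding integrable_acs_def
proof (intro allI impI ballI)
  fix X Y x assume XY: "smooth_vfield A X" "smooth_vfield A Y" and x: "x \<in> carrier A"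
  note d = XY[THEN smooth_vfield_differentiable]
  note dJ = d[THEN chart_acs_vfield(1)]
  have tangent: "X x \<in> tangent_space A x" "Y x \<in> tangent_space A x"
    using d x unfolding differentiable_vfield_def by blast+
  show "nijenhuis A (chart_acs A I) X Y x = (\<lambda>c. 0)"
  proof
    fix c
    show "nijenhuis A (chart_acs A I) X Y x c = 0"
    proof (cases "c \<in> charts_at A x")
      case True
      then show ?thesis
        by (simp add: nijenhuis_def Let_def chart_acs_apply x lie_bracket_tangent d dJ)
          (simp add: lie_bracket_def chart_acs_vfield(2)[OF d(1)] chart_acs_vfield(2)[OF d(2)]
            chart_acs_apply x tangent I_I linear_diff[OF linear_I])
    next
      case False
      then show ?thesis
        by (simp add: nijenhuis_def Let_def chart_acs_apply x lie_bracket_tangent d dJ)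
          (simp add: lie_bracket_def linear_0[OF linear_I])
    qed
  qed
qed

end

section \<open>Differentials computed in charts\<close>

text \<open>The condition on the neighbourhood, trivial for a continuous map, makes the coordinate expression
  meaningful around the point and is what permits another chart in the target.\<close>

definition has_local_derivative ::
  "('a, 'e::euclidean_space) atlas \<Rightarrow> ('b, 'f::euclidean_space) atlas \<Rightarrow> ('a \<Rightarrow> 'b) \<Rightarrow> 'a \<Rightarrow>
   ('a, 'e) chart \<Rightarrow> ('b, 'f) chart \<Rightarrow> ('e \<Rightarrow> 'f) \<Rightarrow> bool" where
  "has_local_derivative A B f x c d D \<longleftrightarrow>
     c \<in> charts_at A x \<and> d \<in> charts_at B (f x) \<and>
     (\<forall>\<^sub>F u in nhds (snd c x). f (chart_inv c u) \<in> fst d) \<and>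
     ((snd d \<circ> f \<circ> chart_inv c) has_derivative D) (at (snd c x))"

lemma has_local_derivativeI:
  assumes "c \<in> charts_at A x" "d \<in> charts_at B (f x)" "open S" "snd c x \<in> S"
    and "(g has_derivative D) (at (snd c x))"
    and "\<And>u. u \<in> S \<Longrightarrow> f (chart_inv c u) \<in> fst d"
    and "\<And>u. u \<in> S \<Longrightarrow> g u = snd d (f (chart_inv c u))"
  shows "has_local_derivative A B f x c d D"
proof -
  have "(snd d \<circ> f \<circ> chart_inv c has_derivative D) (at (snd c x))"
    by (rule has_derivative_transform_within_open[OF assms(5,3,4)]) (simp add: assms(7))
  moreover have "\<forall>\<^sub>F u in nhds (snd c x). f (chart_inv c u) \<in> fst d"
    unfolding eventually_nhds using assms(3,4,6) by blast
  ultimately show ?thesis using assms(1,2) by (simp add: has_local_derivative_def)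
qed

locale complex_atlas_pair = source: complex_atlas I A + target: complex_atlas K B
  for I :: "'e::euclidean_space \<Rightarrow> 'e" and A :: "('a, 'e) atlas"
    and K :: "'f::euclidean_space \<Rightarrow> 'f" and B :: "('b, 'f) atlas"
begin

text \<open>This frees the differential of a map from the chart that \<open>tangent_map\<close> happens to choose.
  The coordinate expression in the new charts is, near the point, the old one
  composed with two transition maps.\<close>

lemma has_local_derivative_change_charts:
  assumes h: "has_local_derivative A B f x c d D"
    and c': "c' \<in> charts_at A x" and d': "d' \<in> charts_at B (f x)"
  shows "has_local_derivative A B f x c' d'
    (\<lambda>v. frechet_derivative (transition d d') (at (snd d (f x)))
       (D (frechet_derivative (transition c' c) (at (snd c' x)) v)))"
proof -
  let ?g = "snd d \<circ> f \<circ> chart_inv c" and ?\<phi> = "transition c' c" and ?\<psi> = "transition d d'"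
  have c: "c \<in> charts_at A x" and d: "d \<in> charts_at B (f x)"
    and ev: "\<forall>\<^sub>F u in nhds (snd c x). f (chart_inv c u) \<in> fst d"
    and g: "(?g has_derivative D) (at (snd c x))"
    using h unfolding has_local_derivative_def by auto
  note mem = charts_atD[OF c] charts_atD[OF c'] charts_atD[OF d] charts_atD[OF d']
  have g0: "?g (snd c x) = snd d (f x)" by (simp add: source.chart_inv_chart mem)
  have \<phi>0: "?\<phi> (snd c' x) = snd c x" by (simp add: source.transition_chart mem)
  note \<phi> = source.transition_has_derivative(1)[OF c' c]
  have \<phi>_lim: "filterlim ?\<phi> (nhds (snd c x)) (nhds (snd c' x))"
    using has_derivative_continuous[OF \<phi>, unfolded continuous_at tendsto_at_iff_tendsto_nhds]
    unfolding \<phi>0 .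
  have "filterlim ?g (nhds (snd d (f x))) (nhds (snd c x))"
    using has_derivative_continuous[OF g, unfolded continuous_at tendsto_at_iff_tendsto_nhds]
    unfolding g0 .
  moreover have "\<forall>\<^sub>F w in nhds (snd d (f x)). w \<in> snd d ` (fst d \<inter> fst d')"
    by (rule eventually_nhds_in_open) (use target.open_overlap mem in auto)
  ultimately have "\<forall>\<^sub>F u in nhds (snd c x). ?g u \<in> snd d ` (fst d \<inter> fst d')"
    by (rule eventually_compose_filterlim[rotated])
  with ev have "\<forall>\<^sub>F u in nhds (snd c x). f (chart_inv c u) \<in> fst d \<inter> fst d'"
  proof eventually_elim
    case (elim u)
    then show ?case using inj_onD[OF target.inj_chart[OF mem(5)]] by auto
  qed
  then have "\<forall>\<^sub>F u in nhds (snd c' x). f (chart_inv c (?\<phi> u)) \<in> fst d \<inter> fst d'"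
    using \<phi>_lim by (rule eventually_compose_filterlim)
  moreover have "\<forall>\<^sub>F u in nhds (snd c' x). u \<in> snd c' ` (fst c' \<inter> fst c)"
    by (rule eventually_nhds_in_open) (use source.open_overlap mem in auto)
  ultimately have near: "\<forall>\<^sub>F u in nhds (snd c' x). f (chart_inv c' u) \<in> fst d' \<and>
      ?\<psi> (?g (?\<phi> u)) = (snd d' \<circ> f \<circ> chart_inv c') u"
  proof eventually_elim
    case (elim u)
    then obtain y where "u = snd c' y" "y \<in> fst c'" "y \<in> fst c" by blast
    then have "chart_inv c (?\<phi> u) = y" "chart_inv c' u = y"
      by (simp_all add: source.transition_chart source.chart_inv_chart mem)
    with elim(1) show ?case by (simp add: target.transition_chart mem)
  qed
  let ?D = "\<lambda>v. frechet_derivative ?\<psi> (at (snd d (f x)))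
       (D (frechet_derivative ?\<phi> (at (snd c' x)) v))"
  have "(?g has_derivative D) (at (?\<phi> (snd c' x)))" using g \<phi>0 by simp
  from has_derivative_compose[OF \<phi> this]
  have 1: "((\<lambda>u. ?g (?\<phi> u)) has_derivative
      (\<lambda>v. D (frechet_derivative ?\<phi> (at (snd c' x)) v))) (at (snd c' x))" .
  have "(?\<psi> has_derivative frechet_derivative ?\<psi> (at (snd d (f x)))) (at (?g (?\<phi> (snd c' x))))"
    unfolding \<phi>0 g0 by (rule target.transition_has_derivative(1)[OF d d'])
  from has_derivative_compose[OF 1 this]
  have 2: "((\<lambda>u. ?\<psi> (?g (?\<phi> u))) has_derivative ?D) (at (snd c' x))" .
  have "((snd d' \<circ> f \<circ> chart_inv c') has_derivative ?D) (at (snd c' x))"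
  proof (rule has_derivative_transform_eventually[OF 2])
    show "\<forall>\<^sub>F u in at (snd c' x). ?\<psi> (?g (?\<phi> u)) = (snd d' \<circ> f \<circ> chart_inv c') u"
      using near by (auto simp: eventually_at_filter elim: eventually_mono)
    show "?\<psi> (?g (?\<phi> (snd c' x))) = (snd d' \<circ> f \<circ> chart_inv c') (snd c' x)"
      using eventually_nhds_x_imp_x[OF near] by simp
  qed simp
  moreover have "\<forall>\<^sub>F u in nhds (snd c' x). f (chart_inv c' u) \<in> fst d'"
    using near by (rule eventually_mono) simp
  ultimately show ?thesis using c' d' by (simp add: has_local_derivative_def)
qed

lemma tangent_map_eq_coord_tvec:
  assumes h: "has_local_derivative A B f x c d D" and v: "v \<in> tangent_space A x"
  shows "tangent_map A B f x v = coord_tvec B d (f x) (D (v c))"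
proof -
  have c: "c \<in> charts_at A x" using h by (simp add: has_local_derivative_def)
  \<comment> \<open>the chart in which \<open>tangent_map\<close> computes the differential\<close>
  define s where "s = (SOME c. c \<in> charts_at A x)"
  have s: "s \<in> charts_at A x" unfolding s_def using c by (rule someI)
  have "frechet_derivative (snd e \<circ> f \<circ> chart_inv s) (at (snd s x)) (v s) =
     frechet_derivative (transition d e) (at (snd d (f x))) (D (v c))"
    if e: "e \<in> charts_at B (f x)" for e
  proof -
    have "((snd e \<circ> f \<circ> chart_inv s) has_derivative
       (\<lambda>v. frechet_derivative (transition d e) (at (snd d (f x)))
       (D (frechet_derivative (transition s c) (at (snd s x)) v)))) (at (snd s x))"
      using has_local_derivative_change_charts[OF h s e] by (simp add: has_local_derivative_def)
    from fun_cong[OF frechet_derivative_at[OF this, symmetric], of "v s"] show ?thesis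
      unfolding source.tangent_transition[OF v s c, symmetric] .
  qed
  then show ?thesis
    unfolding tangent_map_def coord_tvec_def Let_def s_def[symmetric]
    by (intro ext if_cong refl)
qed

lemma tangent_map_tangent:
  assumes "has_local_derivative A B f x c d D" "v \<in> tangent_space A x"
  shows "tangent_map A B f x v \<in> tangent_space B (f x)"
  unfolding tangent_map_eq_coord_tvec[OF assms]
  by (rule target.coord_tvec_tangent) (use assms(1) in \<open>simp add: has_local_derivative_def\<close>)

lemma tangent_map_chart:
  assumes "has_local_derivative A B f x c d D" "v \<in> tangent_space A x"
  shows "tangent_map A B f x v d = D (v c)"
  unfolding tangent_map_eq_coord_tvec[OF assms]
  by (rule target.coord_tvec_same) (use assms(1) in \<open>simp add: has_local_derivative_def\<close>)

text \<open>A map is almost holomorphic at a point as soon as its derivative in one pair of charts commutes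
  with the structures of the model spaces.\<close>

lemma tangent_map_chart_acs:
  assumes h: "has_local_derivative A B f x c d D" and v: "v \<in> tangent_space A x"
    and D: "\<And>w. D (I w) = K (D w)"
  shows "tangent_map A B f x (chart_acs A I x v) = chart_acs B K (f x) (tangent_map A B f x v)"
proof -
  have cd: "c \<in> charts_at A x" "d \<in> charts_at B (f x)"
    using h by (simp_all add: has_local_derivative_def)
  have carriers: "x \<in> carrier A" "f x \<in> carrier B"
    using cd by (auto intro: charts_at_carrier)
  note Iv = source.tangent_I[OF v]
  show ?thesis
    unfolding source.chart_acs_apply[OF carriers(1) v]
      target.chart_acs_apply[OF carriers(2) tangent_map_tangent[OF h v]]
  proof (rule target.tangent_eqI[OF _ _ cd(2)])
    show "tangent_map A B f x (\<lambda>c. I (v c)) d = K (tangent_map A B f x v d)"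
      by (simp add: tangent_map_chart[OF h v] tangent_map_chart[OF h Iv] D)
  qed (intro tangent_map_tangent[OF h Iv] target.tangent_I tangent_map_tangent[OF h v])+
qed

end

section \<open>Products of complex manifolds\<close>

definition prod_chart :: "('a, 'e) chart \<Rightarrow> ('b, 'f) chart \<Rightarrow> ('a \<times> 'b, 'e \<times> 'f) chart" where
  "prod_chart c d = (fst c \<times> fst d, map_prod (snd c) (snd d))"

lemma product_atlas_iff:
  "e \<in> product_atlas A B \<longleftrightarrow> (\<exists>c\<in>A. \<exists>d\<in>B. e = prod_chart c d)"
  unfolding product_atlas_def prod_chart_def by blast

lemma prod_chart_at: "c \<in> charts_at A x \<Longrightarrow> d \<in> charts_at B y \<Longrightarrow>
    prod_chart c d \<in> charts_at (product_atlas A B) (x, y)"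
  unfolding charts_at_def product_atlas_iff by (auto simp: prod_chart_def)

lemma carrier_product_atlas: "carrier (product_atlas A B) = carrier A \<times> carrier B"
proof (intro set_eqI iffI)
  fix q assume "q \<in> carrier (product_atlas A B)"
  then obtain e where "e \<in> product_atlas A B" "q \<in> fst e" unfolding carrier_def by blast
  then obtain c d where "c \<in> A" "d \<in> B" "q \<in> fst (prod_chart c d)"
    unfolding product_atlas_iff by blast
  then show "q \<in> carrier A \<times> carrier B"
    unfolding carrier_def prod_chart_def by (cases q) auto
next
  fix q assume "q \<in> carrier A \<times> carrier B"
  then obtain x y c d where "q = (x, y)" "c \<in> charts_at A x" "d \<in> charts_at B y"
    by (metis SigmaE carrierE)
  then show "q \<in> carrier (product_atlas A B)"
    using charts_at_carrier[OF prod_chart_at[of c A x d B y]] by simp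
qed

lemma prod_chart_overlap:
  "snd (prod_chart c d) ` (fst (prod_chart c d) \<inter> fst (prod_chart c' d'))
    = snd c ` (fst c \<inter> fst c') \<times> snd d ` (fst d \<inter> fst d')"
  unfolding prod_chart_def by (auto simp: image_iff)

context complex_atlas_pair
begin

abbreviation "AB \<equiv> product_atlas A B"

lemma chart_inv_prod_chart:
  assumes "c \<in> A" "d \<in> B" "w \<in> chart_image (prod_chart c d)"
  shows "chart_inv (prod_chart c d) w = (chart_inv c (fst w), chart_inv d (snd w))"
proof -
  obtain x y where xy: "x \<in> fst c" "y \<in> fst d" "w = (snd c x, snd d y)"
    using assms(3) by (auto simp: chart_image_def prod_chart_def)
  have inj: "inj_on (snd (prod_chart c d)) (fst (prod_chart c d))"
    using source.inj_chart[OF assms(1)] target.inj_chart[OF assms(2)]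
    by (simp add: prod_chart_def map_prod_inj_on)
  have "chart_inv (prod_chart c d) (snd (prod_chart c d) (x, y)) = (x, y)"
    unfolding chart_inv_def using xy by (intro inv_into_f_f[OF inj]) (simp add: prod_chart_def)
  then show ?thesis
    using xy assms(1,2) source.chart_inv_chart target.chart_inv_chart
    by (simp add: prod_chart_def)
qed

lemma complex_atlas_product: "complex_atlas (map_prod I K) AB"
proof (rule complex_atlas.intro)
  show "linear (map_prod I K)"
    using source.linear_I target.linear_I by (auto intro!: linearI simp: linear_add linear_scale)
  show "map_prod I K (map_prod I K v) = - v" for v
    by (cases v) (simp add: source.I_I target.I_I)
next
  fix e assume "e \<in> AB"
  then obtain c d where "c \<in> A" "d \<in> B" and e: "e = prod_chart c d"
    unfolding product_atlas_iff by blast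
  then show "inj_on (snd e) (fst e)"
    unfolding e prod_chart_def fst_conv snd_conv
    by (intro map_prod_inj_on source.inj_chart target.inj_chart)
next
  fix e e' assume "e \<in> AB" "e' \<in> AB"
  then obtain c d c' d' where cd: "c \<in> A" "d \<in> B" "c' \<in> A" "d' \<in> B"
    and e: "e = prod_chart c d" and e': "e' = prod_chart c' d'"
    unfolding product_atlas_iff by blast
  show op: "open (snd e ` (fst e \<inter> fst e'))"
    unfolding e e' prod_chart_overlap
    by (intro open_Times source.open_overlap target.open_overlap cd)
  show "complex_C2_on (map_prod I K) (map_prod I K) (snd e ` (fst e \<inter> fst e')) (transition e e')"
  proof (rule complex_C2_on_cong[OF _ op])
    show "complex_C2_on (map_prod I K) (map_prod I K) (snd e ` (fst e \<inter> fst e'))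
        (map_prod (transition c c') (transition d d'))"
      unfolding e e' prod_chart_overlap
      by (intro complex_C2_on_map_prod source.transition_C2 target.transition_C2 cd
          source.linear_I target.linear_I)
    fix w assume "w \<in> snd e ` (fst e \<inter> fst e')"
    then have "w \<in> chart_image (prod_chart c d)" unfolding e chart_image_def by blast
    from chart_inv_prod_chart[OF cd(1,2) this]
    show "map_prod (transition c c') (transition d d') w = transition e e' w"
      unfolding e e' transition_def by (cases w) (simp add: prod_chart_def)
  qed
qed

lemma has_local_derivative_projections:
  assumes "c \<in> charts_at A x" "d \<in> charts_at B y"
  shows "has_local_derivative AB A fst (x, y) (prod_chart c d) c fst"
    and "has_local_derivative AB B snd (x, y) (prod_chart c d) d snd"
proof -
  interpret AB: complex_atlas "map_prod I K" AB by (rule complex_atlas_product)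
  let ?e = "prod_chart c d"
  have e: "?e \<in> charts_at AB (x, y)" by (rule prod_chart_at[OF assms])
  have op: "open (chart_image ?e)" using AB.open_chart_image charts_atD[OF e] by blast
  have mem: "snd ?e (x, y) \<in> chart_image ?e" using charts_atD[OF e] by (simp add: chart_image_def)
  have cd: "c \<in> A" "d \<in> B" using charts_atD(1)[OF assms(1)] charts_atD(1)[OF assms(2)] by simp_all
  have im: "fst u \<in> chart_image c" "snd u \<in> chart_image d" if "u \<in> chart_image ?e" for u
    using that by (auto simp: chart_image_def prod_chart_def)
  have c': "c \<in> charts_at A (fst (x, y))" and d': "d \<in> charts_at B (snd (x, y))"
    using assms by simp_all
  show "has_local_derivative AB A fst (x, y) ?e c fst"
  proof (rule has_local_derivativeI[where f = fst and g = fst and D = fst, OF e c' op mem has_derivative_fst[OF has_derivative_ident]])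
    fix u assume u: "u \<in> chart_image ?e"
    show "fst (chart_inv ?e u) \<in> fst c" "fst u = snd c (fst (chart_inv ?e u))"
      unfolding chart_inv_prod_chart[OF cd u] fst_conv
      by (rule chart_inv_in_domain[OF im(1)[OF u]]) (rule chart_chart_inv[OF im(1)[OF u], symmetric])
  qed
  show "has_local_derivative AB B snd (x, y) ?e d snd"
  proof (rule has_local_derivativeI[where f = snd and g = snd and D = snd, OF e d' op mem has_derivative_snd[OF has_derivative_ident]])
    fix u assume u: "u \<in> chart_image ?e"
    show "snd (chart_inv ?e u) \<in> fst d" "snd u = snd d (snd (chart_inv ?e u))"
      unfolding chart_inv_prod_chart[OF cd u] snd_conv
      by (rule chart_inv_in_domain[OF im(2)[OF u]]) (rule chart_chart_inv[OF im(2)[OF u], symmetric])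
  qed
qed

lemma tangent_map_projections:
  assumes cd: "c \<in> charts_at A x" "d \<in> charts_at B y" and v: "v \<in> tangent_space AB (x, y)"
  shows "tangent_map AB A fst (x, y) v \<in> tangent_space A x"
    and "tangent_map AB A fst (x, y) v c = fst (v (prod_chart c d))"
    and "tangent_map AB B snd (x, y) v \<in> tangent_space B y"
    and "tangent_map AB B snd (x, y) v d = snd (v (prod_chart c d))"
proof -
  interpret f: complex_atlas_pair "map_prod I K" AB I A
    by (intro complex_atlas_pair.intro complex_atlas_product source.complex_atlas_axioms)
  interpret s: complex_atlas_pair "map_prod I K" AB K B
    by (intro complex_atlas_pair.intro complex_atlas_product target.complex_atlas_axioms)
  note h = has_local_derivative_projections[OF cd]
  show "tangent_map AB A fst (x, y) v \<in> tangent_space A x"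
    using f.tangent_map_tangent[OF h(1) v] by simp
  show "tangent_map AB B snd (x, y) v \<in> tangent_space B y"
    using s.tangent_map_tangent[OF h(2) v] by simp
  show "tangent_map AB A fst (x, y) v c = fst (v (prod_chart c d))"
    by (rule f.tangent_map_chart[OF h(1) v])
  show "tangent_map AB B snd (x, y) v d = snd (v (prod_chart c d))"
    by (rule s.tangent_map_chart[OF h(2) v])
qed

text \<open>The definition of \<open>product_acs\<close> describes the value by its two projections. It exists and is unique
  because in a product chart the projections of a vector are its two components.\<close>

lemma product_acs_chart:
  assumes cd: "c \<in> charts_at A x" "d \<in> charts_at B y" and v: "v \<in> tangent_space AB (x, y)"
    and J: "J x (tangent_map AB A fst (x, y) v) \<in> tangent_space A x"
    and L: "L y (tangent_map AB B snd (x, y) v) \<in> tangent_space B y"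
  shows "product_acs A J B L (x, y) v \<in> tangent_space AB (x, y)"
    and "product_acs A J B L (x, y) v (prod_chart c d)
      = (J x (tangent_map AB A fst (x, y) v) c, L y (tangent_map AB B snd (x, y) v) d)"
proof -
  interpret AB: complex_atlas "map_prod I K" AB by (rule complex_atlas_product)
  let ?e = "prod_chart c d"
  let ?v1 = "J x (tangent_map AB A fst (x, y) v)" and ?v2 = "L y (tangent_map AB B snd (x, y) v)"
  have e: "?e \<in> charts_at AB (x, y)" by (rule prod_chart_at[OF cd])
  define w where "w = coord_tvec AB ?e (x, y) (?v1 c, ?v2 d)"
  have w: "w \<in> tangent_space AB (x, y)" "w ?e = (?v1 c, ?v2 d)"
    unfolding w_def by (rule AB.coord_tvec_tangent[OF e]) (rule AB.coord_tvec_same[OF e])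
  note p = tangent_map_projections[OF cd]
  have "(THE w. w \<in> tangent_space AB (x, y) \<and> tangent_map AB A fst (x, y) w = ?v1
      \<and> tangent_map AB B snd (x, y) w = ?v2) = w"
  proof (rule the_equality)
    show "w \<in> tangent_space AB (x, y) \<and> tangent_map AB A fst (x, y) w = ?v1
      \<and> tangent_map AB B snd (x, y) w = ?v2"
      using source.tangent_eqI[OF p(1)[OF w(1)] J cd(1)] target.tangent_eqI[OF p(3)[OF w(1)] L cd(2)]
        p(2,4)[OF w(1)] w by simp
  next
    fix z assume z: "z \<in> tangent_space AB (x, y) \<and> tangent_map AB A fst (x, y) z = ?v1
      \<and> tangent_map AB B snd (x, y) z = ?v2"
    then have "z ?e = w ?e"
      using p(2,4)[OF conjunct1[OF z]] w(2) by (metis prod.collapse)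
    then show "z = w" using z by (intro AB.tangent_eqI[OF _ w(1) e]) auto
  qed
  moreover have "(x, y) \<in> carrier AB" using e by (rule charts_at_carrier)
  ultimately have "product_acs A J B L (x, y) v = w" using v by (simp add: product_acs_def Let_def)
  then show "product_acs A J B L (x, y) v \<in> tangent_space AB (x, y)"
    "product_acs A J B L (x, y) v ?e = (?v1 c, ?v2 d)" using w by simp_all
qed

text \<open>For structures that are constant in charts the product structure is constant in the product charts,
  so that \<open>tangent_map_chart_acs\<close> applies to maps out of a product.\<close>

lemma product_acs_chart_acs:
  assumes q: "q \<in> carrier AB" and v: "v \<in> tangent_space AB q"
  shows "product_acs A (chart_acs A I) B (chart_acs B K) q v = chart_acs AB (map_prod I K) q v"
proof -
  interpret AB: complex_atlas "map_prod I K" AB by (rule complex_atlas_product)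
  obtain x y where xy: "q = (x, y)" by (cases q)
  have x: "x \<in> carrier A" and y: "y \<in> carrier B" using q by (simp_all add: xy carrier_product_atlas)
  obtain c where c: "c \<in> charts_at A x" using x by (rule carrierE)
  obtain d where d: "d \<in> charts_at B y" using y by (rule carrierE)
  have v': "v \<in> tangent_space AB (x, y)" using v by (simp add: xy)
  note p = tangent_map_projections[OF c d v']
  have J: "chart_acs A I x (tangent_map AB A fst (x, y) v) \<in> tangent_space A x"
    unfolding source.chart_acs_apply[OF x p(1)] by (rule source.tangent_I[OF p(1)])
  have L: "chart_acs B K y (tangent_map AB B snd (x, y) v) \<in> tangent_space B y"
    unfolding target.chart_acs_apply[OF y p(3)] by (rule target.tangent_I[OF p(3)])
  note r = product_acs_chart[where J = "chart_acs A I" and L = "chart_acs B K", OF c d v' J L]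
  show ?thesis
    unfolding AB.chart_acs_apply[OF q v] unfolding xy
  proof (rule AB.tangent_eqI[OF r(1) AB.tangent_I[OF v'] prod_chart_at[OF c d]])
    show "product_acs A (chart_acs A I) B (chart_acs B K) (x, y) v (prod_chart c d)
        = map_prod I K (v (prod_chart c d))"
      unfolding r(2) source.chart_acs_apply[OF x p(1)] target.chart_acs_apply[OF y p(3)] p(2,4)
      by (simp add: prod_eq_iff)
  qed
qed

end

lemma vector_scalar_mult_i_twice: "\<i> *s (\<i> *s (v :: complex ^ 'n)) = - v"
  by (simp add: vec_eq_iff)

lemma map_matrix_i_twice:
  "map_matrix ((*) \<i>) (map_matrix ((*) \<i>) (M :: complex ^ 'n ^ 'm)) = - M"
  by (simp add: vec_eq_iff)

lemma complex_linearI: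
  fixes f :: "complex ^ 'n \<Rightarrow> complex ^ 'm"
  assumes "\<And>u v. f (u + v) = f u + f v" "\<And>a u. f (a *s u) = a *s f u"
  shows "Vector_Spaces.linear (*s) (*s) f"
  by unfold_locales (simp_all add: assms)

lemma has_derivative_vec:
  fixes f :: "'e::real_normed_vector \<Rightarrow> complex ^ 'n"
  assumes "\<And>i. ((\<lambda>x. f x $ i) has_derivative (\<lambda>v. f' v $ i)) (at x)"
  shows "(f has_derivative f') (at x)"
  unfolding has_derivative_componentwise_within[of f]
proof
  fix b :: "complex ^ 'n" assume "b \<in> Basis"
  then obtain i c where "b = axis i c" by (auto simp: Basis_vec_def)
  then show "((\<lambda>x. f x \<bullet> b) has_derivative (\<lambda>x. f' x \<bullet> b)) (at x)"
    using has_derivative_inner_left[OF assms[of i], of c] by (simp add: inner_axis)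
qed

section \<open>Projective maps in affine coordinates\<close>

text \<open>The inclusion of the hyperplane \<open>z\<^sub>k = 0\<close>, in the coordinates which the chart \<open>cp_chart k\<close> uses on the
  parallel hyperplane \<open>z\<^sub>k = 1\<close>. The \<open>case\<close> expression inverts \<open>other_index k\<close>: the index \<open>None\<close> is stored in the
  position left free by \<open>k\<close>.\<close>

definition hyperplane_emb :: "'n option \<Rightarrow> complex ^ 'n \<Rightarrow> complex ^ ('n::finite option)" where
  "hyperplane_emb k v = (\<chi> j. if j = k then 0 else v $ (case j of None \<Rightarrow> the k | Some i \<Rightarrow> i))"

text \<open>The point of the affine hyperplane \<open>z\<^sub>k = 1\<close> with affine coordinates \<open>u\<close>.\<close>

definition homogeneous :: "'n option \<Rightarrow> complex ^ 'n \<Rightarrow> complex ^ ('n::finite option)" where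
  "homogeneous k u = axis k 1 + hyperplane_emb k u"

lemma other_index_neq: "other_index k i \<noteq> k"
  by (cases k) (auto simp: other_index_def)

lemma hyperplane_emb_nth:
  "hyperplane_emb k v $ k = 0" "hyperplane_emb k v $ other_index k i = v $ i"
  by (auto simp: hyperplane_emb_def other_index_def)

lemma other_index_surj:
  assumes "j \<noteq> k" obtains i where "j = other_index k i"
proof
  show "j = other_index k (case j of None \<Rightarrow> the k | Some i \<Rightarrow> i)"
    using assms by (auto simp: other_index_def split: option.split)
qed

lemma homogeneous_nth:
  "homogeneous k u $ k = 1" "homogeneous k u $ other_index k i = u $ i"
  using other_index_neq[of k i] by (auto simp: homogeneous_def hyperplane_emb_nth axis_def)

lemma homogeneous_eqI:
  assumes "z $ k = 1" "\<And>i. z $ other_index k i = u $ i"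
  shows "z = homogeneous k u"
proof -
  have "z $ j = homogeneous k u $ j" for j
    by (cases "j = k") (metis assms homogeneous_nth other_index_surj)+
  then show ?thesis by (simp add: vec_eq_iff)
qed

lemma hyperplane_emb_linear:
  "hyperplane_emb k (u + v) = hyperplane_emb k u + hyperplane_emb k v"
  "hyperplane_emb k (a *s v) = a *s hyperplane_emb k v"
  "hyperplane_emb k (r *\<^sub>R v) = r *\<^sub>R hyperplane_emb k v"
  by (auto simp: hyperplane_emb_def vec_eq_iff)

lemma line_of_scale:
  assumes "a \<noteq> 0"
  shows "line_of (a *s z) = line_of z"
proof (intro set_eqI iffI)
  fix w assume "w \<in> line_of (a *s z)"
  then show "w \<in> line_of z" by (auto simp: line_of_def)
next
  fix w assume "w \<in> line_of z"
  then obtain b where "w = b *s z" by (auto simp: line_of_def)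
  then have "w = (b / a) *s (a *s z)" using assms by simp
  then show "w \<in> line_of (a *s z)" unfolding line_of_def by (rule range_eqI)
qed

lemma line_of_in_cp_chart: "line_of z \<in> fst (cp_chart k) \<longleftrightarrow> z $ k \<noteq> 0"
proof
  assume "line_of z \<in> fst (cp_chart k)"
  then obtain w where "w \<in> line_of z" "w $ k \<noteq> 0" by (auto simp: cp_chart_def)
  then show "z $ k \<noteq> 0" by (auto simp: line_of_def)
qed (rule cp_chart_domain)

lemma cp_chart_homogeneous:
  "line_of (homogeneous k u) \<in> fst (cp_chart k)"
  "snd (cp_chart k) (line_of (homogeneous k u)) = u"
  by (simp_all add: line_of_in_cp_chart cp_chart_line_of homogeneous_nth vec_eq_iff)

lemma chart_inv_cp_chart: "chart_inv (cp_chart k) u = line_of (homogeneous k u)"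
  using inv_into_f_f[OF bij_betw_imp_inj_on[OF cp_chart_bij] cp_chart_homogeneous(1), of k u]
  by (simp add: chart_inv_def cp_chart_homogeneous(2))

lemma line_of_homogeneous:
  assumes "x \<in> fst (cp_chart k)"
  shows "x = line_of (homogeneous k (snd (cp_chart k) x))"
proof -
  have "chart_inv (cp_chart k) (snd (cp_chart k) x) = x"
    unfolding chart_inv_def
    by (rule inv_into_f_f[OF bij_betw_imp_inj_on[OF cp_chart_bij] assms])
  then show ?thesis by (simp add: chart_inv_cp_chart)
qed

text \<open>The linear fractional map by which \<open>U\<close> acts from the \<open>k\<close>-th to the \<open>l\<close>-th affine chart. For \<open>U = mat 1\<close> it is
  the transition map between these charts.\<close>

definition cp_map ::
  "complex ^ ('n option) ^ ('n option) \<Rightarrow> 'n option \<Rightarrow> 'n option \<Rightarrow> complex ^ 'n \<Rightarrow> complex ^ ('n::finite)"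
  where "cp_map U k l u =
    (\<chi> i. (U *v homogeneous k u) $ other_index l i / (U *v homogeneous k u) $ l)"

definition cp_domain ::
  "complex ^ ('n option) ^ ('n option) \<Rightarrow> 'n option \<Rightarrow> 'n option \<Rightarrow> (complex ^ ('n::finite)) set"
  where "cp_domain U k l = {u. (U *v homogeneous k u) $ l \<noteq> 0}"

text \<open>The quotient rule applied to \<open>cp_map\<close>, whose numerators and denominator are affine functions with linear
  part \<open>U *v hyperplane_emb k v\<close>.\<close>

definition cp_deriv ::
  "complex ^ ('n option) ^ ('n option) \<Rightarrow> 'n option \<Rightarrow> 'n option \<Rightarrow> complex ^ 'n \<Rightarrow>
    complex ^ 'n \<Rightarrow> complex ^ ('n::finite)"
  where "cp_deriv U k l u v =
    (\<chi> i. ((U *v hyperplane_emb k v) $ other_index l i * (U *v homogeneous k u) $ l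
         - (U *v homogeneous k u) $ other_index l i * (U *v hyperplane_emb k v) $ l)
       / ((U *v homogeneous k u) $ l * (U *v homogeneous k u) $ l))"

definition cp_jac ::
  "complex ^ ('n option) ^ ('n option) \<Rightarrow> 'n option \<Rightarrow> 'n option \<Rightarrow> complex ^ 'n \<Rightarrow>
    complex ^ 'n ^ ('n::finite)"
  where "cp_jac U k l u = matrix (cp_deriv U k l u)"

lemma homogeneous_cp_map:
  assumes "u \<in> cp_domain U k l"
  shows "U *v homogeneous k u = (U *v homogeneous k u) $ l *s homogeneous l (cp_map U k l u)"
proof -
  let ?z = "U *v homogeneous k u"
  have nz: "?z $ l \<noteq> 0" using assms by (simp add: cp_domain_def)
  have "(1 / ?z $ l) *s ?z = homogeneous l (cp_map U k l u)"
    by (rule homogeneous_eqI) (use nz in \<open>simp_all add: cp_map_def\<close>)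
  then have "?z $ l *s ((1 / ?z $ l) *s ?z) = ?z $ l *s homogeneous l (cp_map U k l u)" by simp
  then show ?thesis using nz by simp
qed

lemma cp_action_in_charts:
  assumes "u \<in> cp_domain U k l"
  shows "cp_action U (chart_inv (cp_chart k) u) \<in> fst (cp_chart l)"
    and "snd (cp_chart l) (cp_action U (chart_inv (cp_chart k) u)) = cp_map U k l u"
  using assms
  by (simp_all add: chart_inv_cp_chart cp_action_line_of line_of_in_cp_chart cp_chart_line_of
      cp_domain_def cp_map_def)

lemma linear_cp_numerator: "linear (\<lambda>v. (U *v hyperplane_emb k v) $ j)"
  by (rule linearI) (simp_all add: hyperplane_emb_linear matrix_vector_right_distrib
      linear_scale[OF matrix_vector_mul_linear])

lemma cp_numerator_affine:
  "(U *v homogeneous k u) $ j = (U *v axis k 1) $ j + (U *v hyperplane_emb k u) $ j"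
  by (simp add: homogeneous_def matrix_vector_right_distrib)

lemma complex_C2_cp_numerator:
  "complex_C2_on ((*s) \<i>) ((*) \<i>) S (\<lambda>u. (U *v homogeneous k u) $ j)"
  unfolding cp_numerator_affine
  by (intro complex_C2_on_add complex_C2_on_const complex_C2_on_linear linear_cp_numerator)
    (auto simp: hyperplane_emb_linear vector_scalar_commute intro!: linearI simp: algebra_simps)

lemma has_derivative_cp_numerator:
  "((\<lambda>u. (U *v homogeneous k u) $ j) has_derivative (\<lambda>v. (U *v hyperplane_emb k v) $ j)) (at u)"
proof -
  have "((\<lambda>v. (U *v hyperplane_emb k v) $ j) has_derivative (\<lambda>v. (U *v hyperplane_emb k v) $ j)) (at u)"
    using linear_cp_numerator[of U k j] linear_conv_bounded_linear bounded_linear_imp_has_derivative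
    by blast
  from has_derivative_add[OF has_derivative_const this]
  show ?thesis unfolding cp_numerator_affine by simp
qed

lemma open_cp_domain: "open (cp_domain U k l)"
  unfolding cp_domain_def
  by (intro open_Collect_neq continuous_on_const
      complex_C2_on_imp_continuous_on[OF complex_C2_cp_numerator])

lemma cp_jac_mult: "cp_jac U k l u *v v = cp_deriv U k l u v"
  unfolding cp_jac_def
  by (intro matrix_works complex_linearI)
    (simp_all add: cp_deriv_def vec_eq_iff hyperplane_emb_linear vector_scalar_commute
      matrix_vector_right_distrib add_divide_distrib[symmetric] algebra_simps)

lemma has_derivative_cp_map:
  assumes "u \<in> cp_domain U k l"
  shows "(cp_map U k l has_derivative (\<lambda>v. cp_jac U k l u *v v)) (at u)"
proof (rule has_derivative_vec)
  fix i
  show "((\<lambda>u. cp_map U k l u $ i) has_derivative (\<lambda>v. (cp_jac U k l u *v v) $ i)) (at u)"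
    unfolding cp_map_def cp_jac_mult cp_deriv_def vec_lambda_beta
    by (intro has_derivative_divide' has_derivative_cp_numerator)
      (use assms in \<open>simp add: cp_domain_def\<close>)
qed

lemma complex_C2_cp_map: "complex_C2_on ((*s) \<i>) ((*s) \<i>) (cp_domain U k l) (cp_map U k l)"
  unfolding cp_map_def
  by (intro complex_C2_on_vec, unfold vec_lambda_beta,
      intro complex_C2_on_divide complex_C2_cp_numerator) (simp add: cp_domain_def)

lemma complex_C2_cp_jac:
  "complex_C2_on ((*s) \<i>) (map_matrix ((*) \<i>)) (cp_domain U k l) (cp_jac U k l)"
proof (rule complex_C2_on_matrix)
  fix i j
  show "complex_C2_on ((*s) \<i>) ((*) \<i>) (cp_domain U k l) (\<lambda>u. cp_jac U k l u $ i $ j)"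
    unfolding cp_jac_def matrix_def cp_deriv_def vec_lambda_beta diff_conv_add_uminus
      mult_minus_right[symmetric]
    by (intro complex_C2_on_divide complex_C2_on_add complex_C2_on_mult complex_C2_cp_numerator
        complex_C2_on_const)
      (auto simp: cp_domain_def algebra_simps intro!: linearI)
qed

text \<open>Normalizing \<open>U z\<close> by its \<open>l\<close>-th coordinate changes it only by a scalar, which \<open>V\<close> preserves and the
  division in the \<open>k\<close>-th chart removes.\<close>

lemma cp_map_inverse:
  assumes VU: "V ** U = mat 1" and u: "u \<in> cp_domain U k l"
  shows "cp_map U k l u \<in> cp_domain V l k" "cp_map V l k (cp_map U k l u) = u"
proof -
  let ?a = "(U *v homogeneous k u) $ l"
  have a: "?a \<noteq> 0" using u by (simp add: cp_domain_def)
  have "homogeneous k u = V *v (U *v homogeneous k u)"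
    by (simp add: matrix_vector_mul_assoc VU)
  also have "\<dots> = ?a *s (V *v homogeneous l (cp_map U k l u))"
    by (subst homogeneous_cp_map[OF u]) (rule vector_scalar_commute)
  finally have eq: "homogeneous k u $ j = ?a * (V *v homogeneous l (cp_map U k l u)) $ j" for j
    by (metis vector_smult_component)
  have k: "?a * (V *v homogeneous l (cp_map U k l u)) $ k = 1"
    using eq[of k] by (simp add: homogeneous_nth)
  then show "cp_map U k l u \<in> cp_domain V l k" by (auto simp: cp_domain_def)
  have "p / q = ?a * p" if "?a * q = 1" for p q
    using that by (cases "q = 0") (simp_all add: field_simps)
  then have "(V *v homogeneous l (cp_map U k l u)) $ other_index k i
      / (V *v homogeneous l (cp_map U k l u)) $ k = u $ i" for i
    using eq[of "other_index k i"] k by (simp add: homogeneous_nth)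
  then show "cp_map V l k (cp_map U k l u) = u"
    unfolding cp_map_def[of V] by (simp add: vec_eq_iff)
qed

text \<open>The chain rule for \<open>cp_map_inverse\<close>.\<close>

lemma invertible_cp_jac:
  assumes U: "invertible U" and u: "u \<in> cp_domain U k l"
  shows "invertible (cp_jac U k l u)"
proof -
  obtain V where VU: "V ** U = mat 1" using U unfolding invertible_def by blast
  have "((\<lambda>u. cp_map V l k (cp_map U k l u)) has_derivative
      (\<lambda>v. cp_jac V l k (cp_map U k l u) *v (cp_jac U k l u *v v))) (at u)"
    by (rule has_derivative_compose[OF has_derivative_cp_map[OF u]
          has_derivative_cp_map[OF cp_map_inverse(1)[OF VU u]]])
  moreover have "((\<lambda>u. cp_map V l k (cp_map U k l u)) has_derivative (\<lambda>v. v)) (at u)"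
    by (rule has_derivative_transform_within_open[OF has_derivative_ident open_cp_domain u])
      (simp add: cp_map_inverse(2)[OF VU])
  ultimately have "(\<lambda>v. cp_jac V l k (cp_map U k l u) *v (cp_jac U k l u *v v)) = (\<lambda>v. v)"
    by (rule has_derivative_unique)
  then have "cp_jac V l k (cp_map U k l u) ** cp_jac U k l u = mat 1"
    by (simp add: matrix_eq fun_eq_iff matrix_vector_mul_assoc)
  then show ?thesis unfolding invertible_left_inverse by blast
qed

section \<open>The complex atlas of projective space\<close>

lemma cp_action_mat_1: "cp_action (mat 1) L = L"
  by (simp add: cp_action_def)

lemma cp_chart_overlap:
  "snd (cp_chart k) ` (fst (cp_chart k) \<inter> fst (cp_chart l)) = cp_domain (mat 1) k l"
proof (intro set_eqI iffI)
  fix u assume "u \<in> snd (cp_chart k) ` (fst (cp_chart k) \<inter> fst (cp_chart l))"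
  then obtain x where x: "x \<in> fst (cp_chart k)" "x \<in> fst (cp_chart l)" "u = snd (cp_chart k) x"
    by blast
  have "line_of (homogeneous k u) \<in> fst (cp_chart l)"
    using x(2) line_of_homogeneous[OF x(1)] by (simp add: x(3))
  then show "u \<in> cp_domain (mat 1) k l" by (simp add: cp_domain_def line_of_in_cp_chart)
next
  fix u assume "u \<in> cp_domain (mat 1) k l"
  then have "line_of (homogeneous k u) \<in> fst (cp_chart k) \<inter> fst (cp_chart l)"
    by (simp add: cp_domain_def line_of_in_cp_chart homogeneous_nth)
  then show "u \<in> snd (cp_chart k) ` (fst (cp_chart k) \<inter> fst (cp_chart l))"
    by (rule rev_image_eqI) (simp add: cp_chart_homogeneous)
qed

lemma transition_cp_chart:
  "u \<in> cp_domain (mat 1) k l \<Longrightarrow> transition (cp_chart k) (cp_chart l) u = cp_map (mat 1) k l u"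
  using cp_action_in_charts(2)[of u "mat 1" k l] by (simp add: transition_def cp_action_mat_1)

lemma complex_atlas_cp: "complex_atlas ((*s) \<i>) (cp_atlas :: ('n::finite cp_point, 'n cp_model) atlas)"
proof (rule complex_atlas.intro)
  show "linear ((*s) \<i> :: complex ^ 'n \<Rightarrow> complex ^ 'n)" by (rule linear_vector_scalar_mult)
  show "\<i> *s (\<i> *s v) = - v" for v :: "complex ^ 'n" by (rule vector_scalar_mult_i_twice)
next
  fix c :: "('n::finite cp_point, 'n cp_model) chart" assume "c \<in> cp_atlas"
  then show "inj_on (snd c) (fst c)"
    unfolding cp_atlas_def using bij_betw_imp_inj_on[OF cp_chart_bij] by blast
next
  fix c d :: "('n::finite cp_point, 'n cp_model) chart" assume "c \<in> cp_atlas" "d \<in> cp_atlas"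
  then obtain k l where c: "c = cp_chart k" and d: "d = cp_chart l" unfolding cp_atlas_def by blast
  show "open (snd c ` (fst c \<inter> fst d))"
    unfolding c d cp_chart_overlap by (rule open_cp_domain)
  show "complex_C2_on ((*s) \<i>) ((*s) \<i>) (snd c ` (fst c \<inter> fst d)) (transition c d)"
    unfolding c d cp_chart_overlap
    by (rule complex_C2_on_cong[OF complex_C2_cp_map open_cp_domain]) (simp add: transition_cp_chart)
qed

interpretation cp: complex_atlas "(*s) \<i>" "cp_atlas :: ('n::finite cp_point, 'n cp_model) atlas"
  by (rule complex_atlas_cp)

lemma cp_chart_at_iff: "cp_chart k \<in> charts_at cp_atlas x \<longleftrightarrow> x \<in> fst (cp_chart k)"
  by (auto simp: charts_at_def cp_atlas_def)

lemma cp_chart_at_homogeneous: "cp_chart k \<in> charts_at cp_atlas (line_of (homogeneous k u))"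
  by (simp add: cp_chart_at_iff cp_chart_homogeneous)

lemma carrier_cp_atlas: "carrier (cp_atlas :: ('n::finite cp_point, 'n cp_model) atlas) = CP"
proof (intro set_eqI iffI)
  fix x :: "'n cp_point" assume "x \<in> carrier cp_atlas"
  then show "x \<in> CP" by (auto simp: carrier_def cp_atlas_def cp_chart_def)
next
  fix x :: "'n cp_point" assume "x \<in> CP"
  then obtain z where z: "x = line_of z" "z \<noteq> 0" unfolding CP_def by blast
  then obtain k where "z $ k \<noteq> 0" by (auto simp: vec_eq_iff)
  then have "cp_chart k \<in> charts_at cp_atlas x"
    by (simp add: cp_chart_at_iff z line_of_in_cp_chart)
  then show "x \<in> carrier cp_atlas" by (rule charts_at_carrier)
qed

lemma cp_acs_apply: "x \<in> CP \<Longrightarrow> v \<in> tangent_space cp_atlas x \<Longrightarrow> cp_acs x v = (\<lambda>c. \<i> *s v c)"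
  unfolding cp_acs_def by (rule cp.chart_acs_apply) (simp_all add: carrier_cp_atlas)

lemma frechet_derivative_transition_cp:
  assumes "u \<in> cp_domain (mat 1) k l"
  shows "frechet_derivative (transition (cp_chart k) (cp_chart l)) (at u) = (*v) (cp_jac (mat 1) k l u)"
proof -
  have "(transition (cp_chart k) (cp_chart l) has_derivative (*v) (cp_jac (mat 1) k l u)) (at u)"
    by (rule has_derivative_transform_within_open[OF has_derivative_cp_map[OF assms] open_cp_domain assms])
      (rule transition_cp_chart[symmetric])
  then show ?thesis by (rule frechet_derivative_at[symmetric])
qed

section \<open>The complex atlas of the frame bundle\<close>

text \<open>The frame with coordinates \<open>(u, M)\<close> over the \<open>k\<close>-th affine chart, that is, the inverse of the
  trivialization \<open>frame_chart (cp_chart k)\<close>.\<close>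

definition frame_of :: "'n option \<Rightarrow> 'n frame_model \<Rightarrow> ('n::finite) frame" where
  "frame_of k = (\<lambda>(u, M). (line_of (homogeneous k u),
     \<lambda>w. coord_tvec cp_atlas (cp_chart k) (line_of (homogeneous k u)) (M *v w)))"

text \<open>The action of \<open>U\<close> on frames in the trivializations over the \<open>k\<close>-th and \<open>l\<close>-th affine charts; again the
  case \<open>U = mat 1\<close> gives the transition maps.\<close>

definition frame_map ::
  "complex ^ ('n option) ^ ('n option) \<Rightarrow> 'n option \<Rightarrow> 'n option \<Rightarrow> 'n frame_model \<Rightarrow>
    ('n::finite) frame_model" where
  "frame_map U k l = (\<lambda>(u, M). (cp_map U k l u, cp_jac U k l u ** M))"

abbreviation frame_I :: "('n::finite) frame_model \<Rightarrow> 'n frame_model" where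
  "frame_I \<equiv> map_prod ((*s) \<i>) (map_matrix ((*) \<i>))"

abbreviation GL :: "(complex ^ 'n ^ 'n) set" where
  "GL \<equiv> {M. invertible M}"

lemma cp_line_of_homogeneous_in_CP: "line_of (homogeneous k u) \<in> CP"
  using charts_at_carrier[OF cp_chart_at_homogeneous] by (simp add: carrier_cp_atlas)

lemma frame_of_in_frame_bundle:
  assumes M: "invertible M"
  shows "frame_of k (u, M) \<in> frame_bundle"
proof -
  let ?x = "line_of (homogeneous k u)"
  let ?p = "\<lambda>w. coord_tvec cp_atlas (cp_chart k) ?x (M *v w)"
  note c = cp_chart_at_homogeneous[of k u]
  note T = cp.coord_tvec_tangent[OF c] and same = cp.coord_tvec_same[OF c]
  obtain N where N: "M ** N = mat 1" "N ** M = mat 1" using M unfolding invertible_def by blast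
  have "complex_linear_iso ?x ?p"
    unfolding complex_linear_iso_def
  proof (intro conjI allI)
    show "bij_betw ?p UNIV (tangent_space cp_atlas ?x)"
    proof (rule bij_betwI[where g = "\<lambda>v. N *v v (cp_chart k)"])
      show "?p (N *v v (cp_chart k)) = v" if "v \<in> tangent_space cp_atlas ?x" for v
        by (rule cp.tangent_eqI[OF T that c])
          (simp add: same matrix_vector_mul_assoc N)
    qed (auto simp: T same matrix_vector_mul_assoc N)
    show "?p (v + w) = (\<lambda>c. ?p v c + ?p w c)" for v w
      by (rule cp.tangent_eqI[OF T cp.tangent_add[OF T T] c])
        (simp add: same matrix_vector_right_distrib)
    show "?p (r *\<^sub>R v) = (\<lambda>c. r *\<^sub>R ?p v c)" for r v
      by (rule cp.tangent_eqI[OF T cp.tangent_scale[OF T] c])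
        (simp add: same linear_scale[OF matrix_vector_mul_linear])
    show "?p (\<i> *s v) = cp_acs ?x (?p v)" for v
      unfolding cp_acs_apply[OF cp_line_of_homogeneous_in_CP T]
      by (rule cp.tangent_eqI[OF T cp.tangent_I[OF T] c])
        (simp add: same vector_scalar_commute)
  qed
  then show ?thesis
    by (simp add: frame_of_def frame_bundle_def cp_line_of_homogeneous_in_CP)
qed

lemma frame_of_in_chart:
  "invertible M \<Longrightarrow> frame_of k (u, M) \<in> fst (frame_chart (cp_chart k))"
  using frame_of_in_frame_bundle[of M k u]
  by (simp add: frame_chart_def frame_of_def cp_chart_homogeneous)

lemma frame_chart_frame_of: "snd (frame_chart (cp_chart k)) (frame_of k (u, M)) = (u, M)"
  by (simp add: frame_chart_def frame_of_def cp_chart_homogeneous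
      cp.coord_tvec_same[OF cp_chart_at_homogeneous])

text \<open>The matrix is that of \<open>p\<close> in the coordinate frame: \<open>p\<close> is only assumed to be real linear and to
  commute with the complex structures, so complex linearity is assembled from these.\<close>

lemma frame_of_exhaust:
  assumes q: "q \<in> fst (frame_chart (cp_chart k))"
  obtains u M where "invertible M" "q = frame_of k (u, M)"
proof -
  obtain x p where xp: "q = (x, p)" by (cases q)
  have x: "x \<in> fst (cp_chart k)" "x \<in> CP" and p: "complex_linear_iso x p"
    using q by (auto simp: xp frame_chart_def frame_bundle_def)
  have c: "cp_chart k \<in> charts_at cp_atlas x" by (simp add: cp_chart_at_iff x)
  have bij: "bij_betw p UNIV (tangent_space cp_atlas x)"
    and add: "\<And>v w. p (v + w) = (\<lambda>c. p v c + p w c)"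
    and scale: "\<And>r v. p (r *\<^sub>R v) = (\<lambda>c. r *\<^sub>R p v c)"
    and I: "\<And>v. p (\<i> *s v) = cp_acs x (p v)"
    using p unfolding complex_linear_iso_def by auto
  have T: "p v \<in> tangent_space cp_atlas x" for v using bij_betw_apply[OF bij] by simp
  define M where "M = matrix (\<lambda>w. p w (cp_chart k))"
  have "p (a *s w) (cp_chart k) = a *s p w (cp_chart k)" for a w
  proof -
    \<comment> \<open>complex scalars from real ones and \<open>\<i>\<close>\<close>
    have "a *s w = Re a *\<^sub>R w + Im a *\<^sub>R (\<i> *s w)"
      by (simp add: vec_eq_iff complex_eq_iff)
    then have "p (a *s w) (cp_chart k)
        = Re a *\<^sub>R p w (cp_chart k) + Im a *\<^sub>R (\<i> *s p w (cp_chart k))"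
      by (simp add: add scale I cp_acs_apply[OF x(2) T])
    also have "\<dots> = a *s p w (cp_chart k)" by (simp add: vec_eq_iff complex_eq_iff)
    finally show ?thesis .
  qed
  then have M: "M *v w = p w (cp_chart k)" for w
    unfolding M_def by (intro matrix_works complex_linearI) (simp_all add: add)
  have p_eq: "p w = coord_tvec cp_atlas (cp_chart k) x (M *v w)" for w
    by (rule cp.coord_tvec_eqI[OF T c]) (simp add: M)
  have "inj ((*v) M)"
    using bij_betw_imp_inj_on[OF bij] p_eq by (auto simp: inj_on_def)
  then have "invertible M" unfolding invertible_left_inverse matrix_left_invertible_injective .
  moreover have "q = frame_of k (snd (cp_chart k) x, M)"
    using line_of_homogeneous[OF x(1)] p_eq by (simp add: xp frame_of_def fun_eq_iff)
  ultimately show thesis by (rule that)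
qed

lemma bij_betw_frame_chart:
  "bij_betw (snd (frame_chart (cp_chart k))) (fst (frame_chart (cp_chart k))) (UNIV \<times> GL)"
proof (rule bij_betwI[where g = "frame_of k"])
  show "snd (frame_chart (cp_chart k)) \<in> fst (frame_chart (cp_chart k)) \<rightarrow> UNIV \<times> GL"
    by (auto elim!: frame_of_exhaust simp: frame_chart_frame_of)
  show "frame_of k \<in> UNIV \<times> GL \<rightarrow> fst (frame_chart (cp_chart k))"
    by (auto intro: frame_of_in_chart)
  show "frame_of k (snd (frame_chart (cp_chart k)) q) = q" if "q \<in> fst (frame_chart (cp_chart k))" for q
    using that by (auto elim!: frame_of_exhaust simp: frame_chart_frame_of)
  show "snd (frame_chart (cp_chart k)) (frame_of k y) = y" for y
    by (cases y) (simp add: frame_chart_frame_of)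
qed

lemma chart_inv_frame_chart:
  assumes "invertible M"
  shows "chart_inv (frame_chart (cp_chart k)) (u, M) = frame_of k (u, M)"
  using inv_into_f_f[OF bij_betw_imp_inj_on[OF bij_betw_frame_chart] frame_of_in_chart[OF assms], of k u]
  by (simp add: chart_inv_def frame_chart_frame_of)

lemma chart_image_frame_chart: "chart_image (frame_chart (cp_chart k)) = UNIV \<times> GL"
  unfolding chart_image_def by (rule bij_betw_imp_surj_on[OF bij_betw_frame_chart])

lemma frame_of_in_chart_iff:
  assumes "invertible M"
  shows "frame_of k (u, M) \<in> fst (frame_chart (cp_chart l)) \<longleftrightarrow> u \<in> cp_domain (mat 1) k l"
  using frame_of_in_frame_bundle[OF assms, of k u]
  by (simp add: frame_chart_def frame_of_def line_of_in_cp_chart cp_domain_def)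

lemma line_of_cp_map:
  assumes "u \<in> cp_domain U k l"
  shows "line_of (homogeneous l (cp_map U k l u)) = cp_action U (line_of (homogeneous k u))"
proof -
  have "(U *v homogeneous k u) $ l \<noteq> 0" using assms by (simp add: cp_domain_def)
  from line_of_scale[OF this] show ?thesis
    unfolding cp_action_line_of by (metis homogeneous_cp_map[OF assms])
qed

text \<open>The matrix of a frame changes by the derivative of the coordinate change of projective space.\<close>

lemma frame_of_change:
  assumes u: "u \<in> cp_domain (mat 1) k l"
  shows "frame_of k (u, M) = frame_of l (frame_map (mat 1) k l (u, M))"
proof -
  let ?x = "line_of (homogeneous k u)"
  have x: "line_of (homogeneous l (cp_map (mat 1) k l u)) = ?x"
    using line_of_cp_map[OF u] by (simp add: cp_action_mat_1)
  note k = cp_chart_at_homogeneous[of k u]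
  have l: "cp_chart l \<in> charts_at cp_atlas ?x"
    using cp_chart_at_homogeneous[of l "cp_map (mat 1) k l u"] by (simp add: x)
  have "coord_tvec cp_atlas (cp_chart k) ?x \<xi>
      = coord_tvec cp_atlas (cp_chart l) ?x (cp_jac (mat 1) k l u *v \<xi>)" for \<xi>
  proof (rule cp.coord_tvec_eqI[OF cp.coord_tvec_tangent[OF k] l])
    show "coord_tvec cp_atlas (cp_chart k) ?x \<xi> (cp_chart l) = cp_jac (mat 1) k l u *v \<xi>"
      using l by (simp add: coord_tvec_def cp_chart_homogeneous frechet_derivative_transition_cp[OF u])
  qed
  then show ?thesis by (simp add: frame_of_def frame_map_def x matrix_vector_mul_assoc)
qed

lemma transition_frame_chart:
  assumes "u \<in> cp_domain (mat 1) k l" "invertible M"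
  shows "transition (frame_chart (cp_chart k)) (frame_chart (cp_chart l)) (u, M)
    = frame_map (mat 1) k l (u, M)"
  unfolding transition_def o_apply chart_inv_frame_chart[OF assms(2)] frame_of_change[OF assms(1)]
  by (cases "frame_map (mat 1) k l (u, M)") (simp add: frame_chart_frame_of)

lemma frame_chart_overlap:
  fixes k l :: "'n::finite option"
  shows "snd (frame_chart (cp_chart k)) ` (fst (frame_chart (cp_chart k)) \<inter> fst (frame_chart (cp_chart l)))
    = cp_domain (mat 1) k l \<times> GL"
proof (intro set_eqI iffI)
  fix y :: "'n frame_model"
  assume "y \<in> snd (frame_chart (cp_chart k)) `
    (fst (frame_chart (cp_chart k)) \<inter> fst (frame_chart (cp_chart l)))"
  then obtain q where q: "q \<in> fst (frame_chart (cp_chart k))" "q \<in> fst (frame_chart (cp_chart l))"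
    "y = snd (frame_chart (cp_chart k)) q" by blast
  from q(1) obtain u M where M: "invertible M" "q = frame_of k (u, M)" by (rule frame_of_exhaust)
  then show "y \<in> cp_domain (mat 1) k l \<times> GL"
    using q by (simp add: frame_of_in_chart_iff frame_chart_frame_of)
next
  fix y :: "'n frame_model"
  assume "y \<in> cp_domain (mat 1) k l \<times> GL"
  then have "frame_of k y \<in> fst (frame_chart (cp_chart k)) \<inter> fst (frame_chart (cp_chart l))"
    "y = snd (frame_chart (cp_chart k)) (frame_of k y)"
    by (auto simp: frame_of_in_chart frame_of_in_chart_iff frame_chart_frame_of)
  then show "y \<in> snd (frame_chart (cp_chart k)) `
    (fst (frame_chart (cp_chart k)) \<inter> fst (frame_chart (cp_chart l)))" by blast
qed

lemma open_GL: "open GL"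
proof -
  have "continuous_on UNIV (det :: complex ^ 'n ^ 'n \<Rightarrow> complex)"
    unfolding det_def by (intro continuous_intros)
  then have "open {M :: complex ^ 'n ^ 'n. det M \<noteq> 0}"
    by (intro open_Collect_neq continuous_on_const)
  then show ?thesis by (simp add: invertible_det_nz)
qed

lemma complex_C2_frame_map:
  "complex_C2_on frame_I frame_I (cp_domain U k l \<times> GL) (frame_map U k l)"
proof -
  have sub: "cp_domain U k l \<times> GL \<subseteq> fst -` cp_domain U k l" by auto
  have 1: "complex_C2_on frame_I ((*s) \<i>) (cp_domain U k l \<times> GL) (\<lambda>y. cp_map U k l (fst y))"
    by (rule complex_C2_on_subset[OF complex_C2_on_compose_linear_right[OF complex_C2_cp_map linear_fst] sub])
      simp
  have jac: "complex_C2_on frame_I (map_matrix ((*) \<i>)) (cp_domain U k l \<times> GL) (\<lambda>y. cp_jac U k l (fst y))"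
    by (rule complex_C2_on_subset[OF complex_C2_on_compose_linear_right[OF complex_C2_cp_jac linear_fst] sub])
      simp
  have entry: "complex_C2_on frame_I ((*) \<i>) (cp_domain U k l \<times> GL) (\<lambda>y. cp_jac U k l (fst y) $ i $ j)" for i j
    by (rule complex_C2_on_compose_linear_left[OF jac, of "\<lambda>N. N $ i $ j"]) (auto intro!: linearI)
  have 2: "complex_C2_on frame_I (map_matrix ((*) \<i>)) (cp_domain U k l \<times> GL)
      (\<lambda>y. cp_jac U k l (fst y) ** snd y)"
  proof (rule complex_C2_on_matrix)
    fix i j
    have "complex_C2_on frame_I ((*) \<i>) (cp_domain U k l \<times> GL) (\<lambda>y. snd y $ m $ j)" for m
      by (rule complex_C2_on_linear) (auto intro!: linearI)
    then show "complex_C2_on frame_I ((*) \<i>) (cp_domain U k l \<times> GL)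
        (\<lambda>y. (cp_jac U k l (fst y) ** snd y) $ i $ j)"
      unfolding matrix_matrix_mult_def vec_lambda_beta
      by (intro complex_C2_on_sum complex_C2_on_mult entry) (auto intro!: linearI simp: algebra_simps)
  qed
  have "frame_map U k l = (\<lambda>y. (cp_map U k l (fst y), cp_jac U k l (fst y) ** snd y))"
    by (auto simp: frame_map_def)
  then show ?thesis
    using complex_C2_on_Pair[OF 1 2 linear_vector_scalar_mult linear_map_matrix_mult] by simp
qed

lemma linear_frame_I: "linear (frame_I :: ('n::finite) frame_model \<Rightarrow> 'n frame_model)"
proof -
  have "linear ((*s) \<i> :: complex ^ 'n \<Rightarrow> complex ^ 'n)"
    and "linear (map_matrix ((*) \<i>) :: complex ^ 'n ^ 'n \<Rightarrow> complex ^ 'n ^ 'n)"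
    by (rule linear_vector_scalar_mult, rule linear_map_matrix_mult)
  then show ?thesis by (auto intro!: linearI simp: linear_add linear_scale)
qed

lemma complex_atlas_frame: "complex_atlas frame_I (frame_atlas :: (('n::finite) frame, 'n frame_model) atlas)"
proof (rule complex_atlas.intro)
  show "linear (frame_I :: 'n frame_model \<Rightarrow> 'n frame_model)" by (rule linear_frame_I)
  show "frame_I (frame_I v) = - v" for v :: "'n frame_model"
    by (cases v) (simp add: vector_scalar_mult_i_twice map_matrix_i_twice)
next
  fix c :: "('n frame, 'n frame_model) chart" assume "c \<in> frame_atlas"
  then show "inj_on (snd c) (fst c)"
    unfolding frame_atlas_def cp_atlas_def using bij_betw_imp_inj_on[OF bij_betw_frame_chart] by blast
next
  fix c d :: "('n frame, 'n frame_model) chart" assume "c \<in> frame_atlas" "d \<in> frame_atlas"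
  then obtain k l where c: "c = frame_chart (cp_chart k)" and d: "d = frame_chart (cp_chart l)"
    unfolding frame_atlas_def cp_atlas_def by blast
  have op: "open (cp_domain (mat 1) k l \<times> (GL :: (complex ^ 'n ^ 'n) set))"
    by (intro open_Times open_cp_domain open_GL)
  then show "open (snd c ` (fst c \<inter> fst d))" unfolding c d frame_chart_overlap .
  show "complex_C2_on frame_I frame_I (snd c ` (fst c \<inter> fst d)) (transition c d)"
    unfolding c d frame_chart_overlap
    by (rule complex_C2_on_cong[OF complex_C2_frame_map op]) (auto simp: transition_frame_chart)
qed

interpretation frame: complex_atlas frame_I "frame_atlas :: (('n::finite) frame, 'n frame_model) atlas"
  by (rule complex_atlas_frame)

lemma frame_chart_at_frame_of:
  "invertible M \<Longrightarrow> frame_chart (cp_chart k) \<in> charts_at frame_atlas (frame_of k (u, M))"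
  using frame_of_in_chart by (auto simp: charts_at_def frame_atlas_def cp_atlas_def)

lemma frame_bundle_exhaust:
  assumes "q \<in> frame_bundle"
  obtains k u M where "invertible M" "q = frame_of k (u, M)"
proof -
  have "fst q \<in> carrier cp_atlas" using assms by (auto simp: frame_bundle_def carrier_cp_atlas)
  then obtain k where "fst q \<in> fst (cp_chart k)" by (auto simp: carrier_def cp_atlas_def)
  then have "q \<in> fst (frame_chart (cp_chart k))" using assms by (simp add: frame_chart_def)
  then show thesis by (rule frame_of_exhaust) (rule that)
qed

lemma carrier_frame_atlas:
  "carrier (frame_atlas :: ('n::finite frame, 'n frame_model) atlas) = frame_bundle"
proof (intro set_eqI iffI)
  fix q :: "'n frame" assume "q \<in> carrier frame_atlas"
  then show "q \<in> frame_bundle" by (auto simp: carrier_def frame_atlas_def frame_chart_def)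
next
  fix q :: "'n frame" assume "q \<in> frame_bundle"
  then obtain k u M where "invertible M" "q = frame_of k (u, M)" by (rule frame_bundle_exhaust)
  then show "q \<in> carrier frame_atlas" using charts_at_carrier[OF frame_chart_at_frame_of] by simp
qed

section \<open>The actions and the projection in charts\<close>

lemma cp_action_local_derivative:
  assumes u: "u \<in> cp_domain U k l"
  shows "has_local_derivative cp_atlas cp_atlas (cp_action U) (line_of (homogeneous k u))
    (cp_chart k) (cp_chart l) ((*v) (cp_jac U k l u))"
proof (rule has_local_derivativeI[where S = "cp_domain U k l" and g = "cp_map U k l"])
  show "cp_chart k \<in> charts_at cp_atlas (line_of (homogeneous k u))"
    by (rule cp_chart_at_homogeneous)
  show "cp_chart l \<in> charts_at cp_atlas (cp_action U (line_of (homogeneous k u)))"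
    unfolding line_of_cp_map[OF u, symmetric] by (rule cp_chart_at_homogeneous)
  show "(cp_map U k l has_derivative (*v) (cp_jac U k l u))
      (at (snd (cp_chart k) (line_of (homogeneous k u))))"
    unfolding cp_chart_homogeneous by (rule has_derivative_cp_map[OF u])
qed (simp_all add: cp_chart_homogeneous u open_cp_domain cp_action_in_charts)

interpretation cp_cp: complex_atlas_pair
    "(*s) \<i>" "cp_atlas :: ('n::finite cp_point, 'n cp_model) atlas"
    "(*s) \<i>" "cp_atlas :: ('n::finite cp_point, 'n cp_model) atlas"
  by (intro complex_atlas_pair.intro complex_atlas_cp)

text \<open>The differential of the action on projective space is the Jacobian matrix of the linear fractional
  map, and it is applied to each vector of the frame.\<close>

lemma frame_left_action_frame_of:
  assumes u: "u \<in> cp_domain U k l"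
  shows "frame_left_action U (frame_of k (u, M)) = frame_of l (frame_map U k l (u, M))"
  using cp_cp.tangent_map_eq_coord_tvec[OF cp_action_local_derivative[OF u]
      cp.coord_tvec_tangent[OF cp_chart_at_homogeneous]]
  by (simp add: frame_left_action_def frame_of_def frame_map_def line_of_cp_map[OF u]
      cp.coord_tvec_same[OF cp_chart_at_homogeneous] matrix_vector_mul_assoc)

lemma frame_map_invertible:
  assumes "invertible U" "u \<in> cp_domain U k l" "invertible M"
  shows "invertible (cp_jac U k l u ** M)"
  by (intro invertible_mult invertible_cp_jac assms)

lemma frame_left_action_local_derivative:
  fixes k l :: "'n::finite option"
  assumes U: "invertible U" and u: "u \<in> cp_domain U k l" and M: "invertible M"
    and D: "(frame_map U k l has_derivative D) (at (u, M))"
  shows "has_local_derivative frame_atlas frame_atlas (frame_left_action U) (frame_of k (u, M))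
    (frame_chart (cp_chart k)) (frame_chart (cp_chart l)) D"
proof (rule has_local_derivativeI[OF frame_chart_at_frame_of[OF M] _ open_Times[OF open_cp_domain open_GL]])
  show "frame_chart (cp_chart l) \<in> charts_at frame_atlas (frame_left_action U (frame_of k (u, M)))"
    unfolding frame_left_action_frame_of[OF u]
    by (simp add: frame_map_def frame_chart_at_frame_of frame_map_invertible U u M)
  show "(frame_map U k l has_derivative D) (at (snd (frame_chart (cp_chart k)) (frame_of k (u, M))))"
    using D by (simp add: frame_chart_frame_of)
  show "snd (frame_chart (cp_chart k)) (frame_of k (u, M)) \<in> cp_domain U k l \<times> GL"
    using u M by (simp add: frame_chart_frame_of)
  fix y :: "'n frame_model" assume "y \<in> cp_domain U k l \<times> GL"
  then obtain w N where y: "y = (w, N)" "w \<in> cp_domain U k l" "invertible N" by blast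
  then show "frame_left_action U (chart_inv (frame_chart (cp_chart k)) y) \<in> fst (frame_chart (cp_chart l))"
    and "frame_map U k l y = snd (frame_chart (cp_chart l))
      (frame_left_action U (chart_inv (frame_chart (cp_chart k)) y))"
    by (simp_all add: chart_inv_frame_chart frame_left_action_frame_of frame_map_def
        frame_of_in_chart frame_map_invertible U frame_chart_frame_of)
qed

lemma SU_invertible: "U \<in> SU \<Longrightarrow> invertible U"
  unfolding SU_def invertible_left_inverse by blast

text \<open>Every point has an image in some affine chart because an invertible matrix does not annihilate
  homogeneous coordinates.\<close>

lemma cp_domain_exists:
  assumes "invertible U"
  obtains l where "u \<in> cp_domain U k l"
proof -
  obtain V where "V ** U = mat 1" using assms unfolding invertible_def by blast
  then have "V *v (U *v homogeneous k u) = homogeneous k u" by (simp add: matrix_vector_mul_assoc)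
  moreover have "homogeneous k u \<noteq> 0" by (metis homogeneous_nth(1) zero_index zero_neq_one)
  ultimately have "U *v homogeneous k u \<noteq> 0" by (metis matrix_vector_mult_0_right)
  then obtain l where "(U *v homogeneous k u) $ l \<noteq> 0" by (auto simp: vec_eq_iff)
  then show thesis by (intro that[of l]) (simp add: cp_domain_def)
qed

lemma frame_of_right_action: "frame_right_action (frame_of k (u, M), h) = frame_of k (u, M ** h)"
  by (simp add: frame_right_action_def frame_of_def matrix_vector_mul_assoc)

definition GL_chart :: "(complex ^ 'n ^ 'n, complex ^ 'n ^ 'n) chart" where
  "GL_chart = (GL, \<lambda>h. h)"

lemma GL_atlas_eq: "GL_atlas = {GL_chart}"
  by (simp add: GL_atlas_def GL_chart_def)

lemma GL_chart_at: "invertible h \<Longrightarrow> GL_chart \<in> charts_at GL_atlas h"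
  by (simp add: charts_at_def GL_atlas_eq GL_chart_def)

lemma carrier_GL_atlas: "carrier GL_atlas = GL"
  by (simp add: carrier_def GL_atlas_def)

lemma chart_inv_GL_chart: "invertible h \<Longrightarrow> chart_inv GL_chart h = h"
  using inv_into_f_f[of "\<lambda>h. h" GL h] by (simp add: chart_inv_def GL_chart_def)

lemma chart_image_GL_chart: "chart_image GL_chart = GL"
  by (simp add: chart_image_def GL_chart_def)

lemma complex_atlas_GL:
  "complex_atlas (map_matrix ((*) \<i>)) (GL_atlas :: (complex ^ ('n::finite) ^ 'n, complex ^ 'n ^ 'n) atlas)"
proof (rule complex_atlas.intro)
  show "linear (map_matrix ((*) \<i>) :: complex ^ 'n ^ 'n \<Rightarrow> complex ^ 'n ^ 'n)"
    by (rule linear_map_matrix_mult)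
  show "map_matrix ((*) \<i>) (map_matrix ((*) \<i>) v) = - v" for v :: "complex ^ 'n ^ 'n"
    by (rule map_matrix_i_twice)
next
  fix c d :: "(complex ^ ('n::finite) ^ 'n, complex ^ 'n ^ 'n) chart"
  assume "c \<in> GL_atlas" "d \<in> GL_atlas"
  then have c: "c = GL_chart" and d: "d = GL_chart" by (simp_all add: GL_atlas_eq)
  have im: "snd c ` (fst c \<inter> fst d) = GL" by (simp add: c d GL_chart_def)
  show "open (snd c ` (fst c \<inter> fst d))" unfolding im by (rule open_GL)
  have "complex_C2_on (map_matrix ((*) \<i>)) (map_matrix ((*) \<i>)) GL (\<lambda>h :: complex ^ 'n ^ 'n. h)"
    by (rule complex_C2_on_linear) (auto intro: linearI)
  then show "complex_C2_on (map_matrix ((*) \<i>)) (map_matrix ((*) \<i>)) (snd c ` (fst c \<inter> fst d)) (transition c d)"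
    unfolding im
    by (rule complex_C2_on_cong[OF _ open_GL])
      (simp add: transition_def c d chart_inv_GL_chart, simp add: GL_chart_def)
qed (simp add: GL_atlas_eq GL_chart_def)

interpretation GL: complex_atlas "map_matrix ((*) \<i>)"
    "GL_atlas :: (complex ^ ('n::finite) ^ 'n, complex ^ 'n ^ 'n) atlas"
  by (rule complex_atlas_GL)

interpretation frame_GL: complex_atlas_pair
    frame_I "frame_atlas :: ('n::finite frame, 'n frame_model) atlas"
    "map_matrix ((*) \<i>)" "GL_atlas :: (complex ^ ('n::finite) ^ 'n, complex ^ 'n ^ 'n) atlas"
  by (intro complex_atlas_pair.intro complex_atlas_frame complex_atlas_GL)

interpretation frame_GL_frame: complex_atlas_pair
    "map_prod frame_I (map_matrix ((*) \<i>))"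
    "product_atlas frame_atlas GL_atlas :: ('n::finite frame \<times> (complex ^ 'n ^ 'n), 'n frame_model \<times> (complex ^ 'n ^ 'n)) atlas"
    frame_I "frame_atlas :: ('n::finite frame, 'n frame_model) atlas"
  by (intro complex_atlas_pair.intro complex_atlas_frame frame_GL.complex_atlas_product)

interpretation frame_frame: complex_atlas_pair
    frame_I "frame_atlas :: ('n::finite frame, 'n frame_model) atlas"
    frame_I "frame_atlas :: ('n::finite frame, 'n frame_model) atlas"
  by (intro complex_atlas_pair.intro complex_atlas_frame)

interpretation frame_cp: complex_atlas_pair
    frame_I "frame_atlas :: ('n::finite frame, 'n frame_model) atlas"
    "(*s) \<i>" "cp_atlas :: ('n::finite cp_point, 'n cp_model) atlas"
  by (intro complex_atlas_pair.intro complex_atlas_frame complex_atlas_cp)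

lemma frame_projection_local_derivative:
  fixes k :: "'n::finite option"
  assumes M: "invertible M"
  shows "has_local_derivative frame_atlas cp_atlas fst (frame_of k (u, M))
    (frame_chart (cp_chart k)) (cp_chart k) fst"
proof (rule has_local_derivativeI[where g = fst, OF frame_chart_at_frame_of[OF M] _ open_Times[OF open_UNIV open_GL]])
  show "cp_chart k \<in> charts_at cp_atlas (fst (frame_of k (u, M)))"
    by (simp add: frame_of_def cp_chart_at_homogeneous)
  show "snd (frame_chart (cp_chart k)) (frame_of k (u, M)) \<in> UNIV \<times> GL"
    using M by (simp add: frame_chart_frame_of)
  show "(fst has_derivative fst) (at (snd (frame_chart (cp_chart k)) (frame_of k (u, M))))"
    by (rule has_derivative_fst[OF has_derivative_ident])
  fix y :: "'n frame_model" assume "y \<in> UNIV \<times> GL"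
  then obtain w N where y: "y = (w, N)" "invertible N" by blast
  then show "fst (chart_inv (frame_chart (cp_chart k)) y) \<in> fst (cp_chart k)"
    "fst y = snd (cp_chart k) (fst (chart_inv (frame_chart (cp_chart k)) y))"
    by (simp_all add: chart_inv_frame_chart frame_of_def cp_chart_homogeneous)
qed

lemma bounded_bilinear_matrix_mult:
  "bounded_bilinear ((**) :: complex ^ 'n ^ 'm \<Rightarrow> complex ^ 'p ^ 'n \<Rightarrow> complex ^ 'p ^ 'm)"
  unfolding bilinear_conv_bounded_bilinear[symmetric] bilinear_def
  by (auto intro!: linearI simp: vec_eq_iff matrix_matrix_mult_def sum.distrib algebra_simps
      scaleR_sum_right)

lemma frame_right_action_local_derivative:
  fixes k :: "'n::finite option"
  assumes M: "invertible M" and h: "invertible h"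
  shows "has_local_derivative (product_atlas frame_atlas GL_atlas) frame_atlas frame_right_action
    (frame_of k (u, M), h) (prod_chart (frame_chart (cp_chart k)) GL_chart) (frame_chart (cp_chart k))
    (\<lambda>v. (fst (fst v), M ** snd v + snd (fst v) ** h))"
proof (rule has_local_derivativeI[where g = "\<lambda>y. (fst (fst y), snd (fst y) ** snd y)",
      OF prod_chart_at[OF frame_chart_at_frame_of[OF M] GL_chart_at[OF h]] _
        open_Times[OF open_Times[OF open_UNIV open_GL] open_GL]])
  show "frame_chart (cp_chart k) \<in> charts_at frame_atlas (frame_right_action (frame_of k (u, M), h))"
    unfolding frame_of_right_action by (intro frame_chart_at_frame_of invertible_mult M h)
  have base: "snd (prod_chart (frame_chart (cp_chart k)) GL_chart) (frame_of k (u, M), h) = ((u, M), h)"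
    by (simp add: prod_chart_def frame_chart_frame_of GL_chart_def)
  show "snd (prod_chart (frame_chart (cp_chart k)) GL_chart) (frame_of k (u, M), h) \<in> (UNIV \<times> GL) \<times> GL"
    unfolding base using M h by simp
  have "((\<lambda>y. (fst (fst y), snd (fst y) ** snd y)) has_derivative
      (\<lambda>v. (fst (fst v), snd (fst ((u, M), h)) ** snd v + snd (fst v) ** snd ((u, M), h)))) (at ((u, M), h))"
    by (intro has_derivative_Pair bounded_bilinear.FDERIV[OF bounded_bilinear_matrix_mult]
        has_derivative_fst has_derivative_snd has_derivative_ident)
  then show "((\<lambda>y. (fst (fst y), snd (fst y) ** snd y)) has_derivative
      (\<lambda>v. (fst (fst v), M ** snd v + snd (fst v) ** h)))
      (at (snd (prod_chart (frame_chart (cp_chart k)) GL_chart) (frame_of k (u, M), h)))"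
    unfolding base by simp
  fix y :: "'n frame_model \<times> (complex ^ 'n ^ 'n)" assume "y \<in> (UNIV \<times> GL) \<times> GL"
  then obtain w N g where y: "y = ((w, N), g)" "invertible N" "invertible g" by auto
  have "frame_chart (cp_chart k) \<in> frame_atlas" by (simp add: frame_atlas_def cp_atlas_def)
  moreover have "chart_image (prod_chart (frame_chart (cp_chart k))
      (GL_chart :: (complex ^ 'n ^ 'n, complex ^ 'n ^ 'n) chart)) = (UNIV \<times> GL) \<times> GL"
    using prod_chart_overlap[of "frame_chart (cp_chart k)" GL_chart "frame_chart (cp_chart k)" GL_chart]
    unfolding Int_absorb chart_image_def[symmetric] chart_image_frame_chart chart_image_GL_chart .
  then have "y \<in> chart_image (prod_chart (frame_chart (cp_chart k)) GL_chart)" using y by simp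
  ultimately have inv: "chart_inv (prod_chart (frame_chart (cp_chart k)) GL_chart) y = (frame_of k (w, N), g)"
    using frame_GL.chart_inv_prod_chart[of "frame_chart (cp_chart k)" GL_chart y] y
    by (simp add: GL_atlas_eq chart_inv_GL_chart chart_inv_frame_chart)
  show "frame_right_action (chart_inv (prod_chart (frame_chart (cp_chart k)) GL_chart) y)
      \<in> fst (frame_chart (cp_chart k))"
    unfolding inv frame_of_right_action by (intro frame_of_in_chart invertible_mult y)
  show "(fst (fst y), snd (fst y) ** snd y) = snd (frame_chart (cp_chart k))
      (frame_right_action (chart_inv (prod_chart (frame_chart (cp_chart k)) GL_chart) y))"
    unfolding inv frame_of_right_action by (simp add: frame_chart_frame_of y)
qed

section \<open>The standard complexion\<close>

definition frame_acs :: "('n::finite frame, 'n frame_model) endo" where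
  "frame_acs = chart_acs frame_atlas frame_I"

lemma complexion_frame_acs: "complexion (frame_acs :: ('n::finite frame, 'n frame_model) endo)"
  unfolding complexion_def
proof (intro conjI ballI)
  show "almost_complex_structure frame_atlas (frame_acs :: ('n::finite frame, 'n frame_model) endo)"
    unfolding frame_acs_def by (rule frame.chart_acs_almost_complex)
next
  fix q :: "'n frame" and v
  assume q: "q \<in> frame_bundle" and v: "v \<in> tangent_space frame_atlas q"
  from q obtain k u M where M: "invertible M" "q = frame_of k (u, M)" by (rule frame_bundle_exhaust)
  show "tangent_map frame_atlas cp_atlas fst q (frame_acs q v) =
        cp_acs (fst q) (tangent_map frame_atlas cp_atlas fst q v)"
    unfolding frame_acs_def cp_acs_def
    by (rule frame_cp.tangent_map_chart_acs[OF frame_projection_local_derivative[OF M(1), of k u, folded M(2)] v])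
      simp
next
  show "almost_holomorphic (product_atlas frame_atlas GL_atlas)
       (product_acs frame_atlas (frame_acs :: ('n frame, 'n frame_model) endo) GL_atlas GL_acs)
       frame_atlas frame_acs frame_right_action"
    unfolding almost_holomorphic_def
  proof (intro ballI)
    fix q :: "'n frame \<times> (complex ^ 'n ^ 'n)" and v
    assume q: "q \<in> carrier (product_atlas frame_atlas GL_atlas)"
      and v: "v \<in> tangent_space (product_atlas frame_atlas GL_atlas) q"
    obtain p h where ph: "q = (p, h)" by (cases q)
    have p: "p \<in> frame_bundle" and h: "invertible h"
      using q by (simp_all add: ph carrier_product_atlas carrier_frame_atlas carrier_GL_atlas)
    from p obtain k u M where M: "invertible M" "p = frame_of k (u, M)" by (rule frame_bundle_exhaust)
    show "tangent_map (product_atlas frame_atlas GL_atlas) frame_atlas frame_right_action q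
        (product_acs frame_atlas frame_acs GL_atlas GL_acs q v) =
      frame_acs (frame_right_action q)
        (tangent_map (product_atlas frame_atlas GL_atlas) frame_atlas frame_right_action q v)"
      unfolding frame_acs_def GL_acs_def frame_GL.product_acs_chart_acs[OF q v]
    proof (rule frame_GL_frame.tangent_map_chart_acs[OF _ v])
      show "has_local_derivative (product_atlas frame_atlas GL_atlas) frame_atlas frame_right_action q
        (prod_chart (frame_chart (cp_chart k)) GL_chart) (frame_chart (cp_chart k))
        (\<lambda>v. (fst (fst v), M ** snd v + snd (fst v) ** h))"
        unfolding ph M(2) by (rule frame_right_action_local_derivative[OF M(1) h])
    qed (auto simp: vec_eq_iff matrix_matrix_mult_def algebra_simps sum_distrib_left)
  qed
qed

lemma G_invariant_frame_acs: "G_invariant (frame_acs :: ('n::finite frame, 'n frame_model) endo)"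
  unfolding G_invariant_def
proof (intro ballI)
  fix g :: "complex ^ ('n option) ^ ('n option)" and q :: "'n frame" and v
  assume g: "g \<in> SU" and q: "q \<in> frame_bundle"
    and v: "v \<in> tangent_space frame_atlas q"
  from q obtain k u M where M: "invertible M" "q = frame_of k (u, M)" by (rule frame_bundle_exhaust)
  obtain l where u: "u \<in> cp_domain g k l" using cp_domain_exists[OF SU_invertible[OF g]] .
  then have "(u, M) \<in> cp_domain g k l \<times> GL" using M by simp
  from complex_C2_imp_has_derivative[OF complex_C2_frame_map this]
  obtain D where D: "(frame_map g k l has_derivative D) (at (u, M))" "\<And>v. D (frame_I v) = frame_I (D v)"
    by metis
  show "tangent_map frame_atlas frame_atlas (frame_left_action g) q (frame_acs q v) =
      frame_acs (frame_left_action g q) (tangent_map frame_atlas frame_atlas (frame_left_action g) q v)"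
    unfolding frame_acs_def
  proof (rule frame_frame.tangent_map_chart_acs[OF _ v])
    show "has_local_derivative frame_atlas frame_atlas (frame_left_action g) q
        (frame_chart (cp_chart k)) (frame_chart (cp_chart l)) D"
      unfolding M(2) by (rule frame_left_action_local_derivative[OF SU_invertible[OF g] u M(1) D(1)])
  qed (rule D(2))
qed

section \<open>Uniqueness by point reflections\<close>

text \<open>Only two entries of the derivative are needed: the effect on the base, and the effect on vertical
  vectors, where \<open>frame_map\<close> is a left multiplication. The remaining one involves the second derivative
  of \<open>cp_map\<close>.\<close>

lemma frame_map_derivative:
  assumes u: "u \<in> cp_domain U k l" and D: "(frame_map U k l has_derivative D) (at (u, M))"
  shows "fst (D \<xi>) = cp_jac U k l u *v fst \<xi>"
    and "D (0, Z) = (0, cp_jac U k l u ** Z)"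
proof -
  have "((\<lambda>y. fst (frame_map U k l y)) has_derivative (\<lambda>\<xi>. fst (D \<xi>))) (at (u, M))"
    by (rule has_derivative_fst[OF D])
  moreover have "((\<lambda>y. cp_map U k l (fst y)) has_derivative (\<lambda>\<xi>. cp_jac U k l u *v fst \<xi>)) (at (u, M))"
    by (rule has_derivative_compose[OF has_derivative_fst[OF has_derivative_ident]])
      (simp add: has_derivative_cp_map[OF u])
  moreover have "(\<lambda>y. fst (frame_map U k l y)) = (\<lambda>y. cp_map U k l (fst y))"
    by (simp add: frame_map_def fun_eq_iff)
  ultimately have "(\<lambda>\<xi>. fst (D \<xi>)) = (\<lambda>\<xi>. cp_jac U k l u *v fst \<xi>)"
    using has_derivative_unique by metis
  then show "fst (D \<xi>) = cp_jac U k l u *v fst \<xi>" by (rule fun_cong)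
  have "((\<lambda>N. (u, N)) has_derivative (\<lambda>Z. (0, Z))) (at M)"
    by (intro has_derivative_Pair has_derivative_const has_derivative_ident)
  from has_derivative_compose[OF this D]
  have "((\<lambda>N. frame_map U k l (u, N)) has_derivative (\<lambda>Z. D (0, Z))) (at M)" .
  moreover have "((\<lambda>N. frame_map U k l (u, N)) has_derivative (\<lambda>Z. (0, cp_jac U k l u ** Z))) (at M)"
    unfolding frame_map_def prod.case
    by (intro has_derivative_Pair has_derivative_const bounded_linear_imp_has_derivative
        bounded_bilinear.bounded_linear_right[OF bounded_bilinear_matrix_mult])
  ultimately have "(\<lambda>Z. D (0, Z)) = (\<lambda>Z. (0, cp_jac U k l u ** Z))" by (rule has_derivative_unique)
  then show "D (0, Z) = (0, cp_jac U k l u ** Z)" by (rule fun_cong)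
qed

text \<open>The coordinate expression of \<open>J\<close> at the frame with coordinates \<open>y\<close>.\<close>

definition in_frame_chart ::
  "('n::finite frame, 'n frame_model) endo \<Rightarrow> 'n option \<Rightarrow> 'n frame_model \<Rightarrow> 'n frame_model \<Rightarrow> 'n frame_model"
  where "in_frame_chart J k y \<xi> =
    J (frame_of k y) (coord_tvec frame_atlas (frame_chart (cp_chart k)) (frame_of k y) \<xi>)
      (frame_chart (cp_chart k))"

context
  fixes J :: "('n::finite frame, 'n frame_model) endo"
  assumes J: "complexion J"
begin

lemma complexion_tangent:
  "q \<in> frame_bundle \<Longrightarrow> v \<in> tangent_space frame_atlas q \<Longrightarrow> J q v \<in> tangent_space frame_atlas q"
proof -
  assume q: "q \<in> frame_bundle" and v: "v \<in> tangent_space frame_atlas q"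
  have "J \<in> (\<Pi>\<^sub>E x\<in>carrier frame_atlas. tangent_space frame_atlas x \<rightarrow>\<^sub>E tangent_space frame_atlas x)"
    using J unfolding complexion_def almost_complex_structure_def by simp
  from PiE_mem[OF PiE_mem[OF this] v] show ?thesis using q by (simp add: carrier_frame_atlas)
qed

lemma in_frame_chart_add:
  assumes M: "invertible M"
  shows "in_frame_chart J k (u, M) (\<xi> + \<eta>) = in_frame_chart J k (u, M) \<xi> + in_frame_chart J k (u, M) \<eta>"
proof -
  let ?q = "frame_of k (u, M)" and ?c = "frame_chart (cp_chart k)"
  note c = frame_chart_at_frame_of[OF M, of k u]
  note T = frame.coord_tvec_tangent[OF c] and same = frame.coord_tvec_same[OF c]
  have "coord_tvec frame_atlas ?c ?q (\<xi> + \<eta>)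
      = (\<lambda>d. coord_tvec frame_atlas ?c ?q \<xi> d + coord_tvec frame_atlas ?c ?q \<eta> d)"
    by (rule frame.tangent_eqI[OF T frame.tangent_add[OF T T] c]) (simp add: same)
  moreover have "J ?q (\<lambda>d. coord_tvec frame_atlas ?c ?q \<xi> d + coord_tvec frame_atlas ?c ?q \<eta> d)
      = (\<lambda>d. J ?q (coord_tvec frame_atlas ?c ?q \<xi>) d + J ?q (coord_tvec frame_atlas ?c ?q \<eta>) d)"
    using J T charts_at_carrier[OF c] unfolding complexion_def almost_complex_structure_def by blast
  ultimately show ?thesis by (simp add: in_frame_chart_def)
qed

text \<open>This is the condition that \<open>J\<close> covers the complex structure of projective space.\<close>

lemma in_frame_chart_fst:
  assumes M: "invertible M"
  shows "fst (in_frame_chart J k (u, M) \<xi>) = \<i> *s fst \<xi>"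
proof -
  let ?q = "frame_of k (u, M)" and ?c = "frame_chart (cp_chart k)"
  let ?v = "coord_tvec frame_atlas ?c ?q \<xi>"
  note c = frame_chart_at_frame_of[OF M, of k u]
  note T = frame.coord_tvec_tangent[OF c, of \<xi>]
  note q = frame_of_in_frame_bundle[OF M, of k u]
  note d = frame_projection_local_derivative[OF M, of k u]
  have "tangent_map frame_atlas cp_atlas fst ?q (J ?q ?v)
      = cp_acs (fst ?q) (tangent_map frame_atlas cp_atlas fst ?q ?v)"
    using J q T unfolding complexion_def by blast
  also have "\<dots> = (\<lambda>d. \<i> *s tangent_map frame_atlas cp_atlas fst ?q ?v d)"
    by (rule cp_acs_apply[OF _ frame_cp.tangent_map_tangent[OF d T]])
      (simp add: frame_of_def cp_line_of_homogeneous_in_CP)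
  finally have "tangent_map frame_atlas cp_atlas fst ?q (J ?q ?v) (cp_chart k)
      = \<i> *s tangent_map frame_atlas cp_atlas fst ?q ?v (cp_chart k)" by (rule fun_cong)
  then show ?thesis
    by (simp add: frame_cp.tangent_map_chart[OF d T] in_frame_chart_def
        frame_cp.tangent_map_chart[OF d complexion_tangent[OF q T]] frame.coord_tvec_same[OF c])
qed

text \<open>The holomorphy of the right action at the point \<open>(q, h)\<close>, evaluated on the tangent vector \<open>(\<xi>, \<zeta>)\<close>.
  The case \<open>\<zeta> = 0\<close> is the equivariance of \<open>J\<close>, and the case \<open>\<xi> = 0\<close> determines \<open>J\<close> on vertical vectors.\<close>

lemma in_frame_chart_right_action:
  assumes M: "invertible M" and h: "invertible h"
  shows "in_frame_chart J k (u, M ** h) (fst \<xi>, M ** \<zeta> + snd \<xi> ** h)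
    = (fst (in_frame_chart J k (u, M) \<xi>),
       M ** map_matrix ((*) \<i>) \<zeta> + snd (in_frame_chart J k (u, M) \<xi>) ** h)"
proof -
  let ?PH = "product_atlas frame_atlas GL_atlas ::
      ('n frame \<times> (complex ^ 'n ^ 'n), 'n frame_model \<times> (complex ^ 'n ^ 'n)) atlas" and ?q = "frame_of k (u, M)"
    and ?c = "frame_chart (cp_chart k)"
  let ?e = "prod_chart ?c GL_chart"
  let ?D = "\<lambda>v. (fst (fst v), M ** snd v + snd (fst v) ** h)"
  let ?K = "product_acs frame_atlas J GL_atlas GL_acs (?q, h)"
  define w where "w = coord_tvec ?PH ?e (?q, h) (\<xi>, \<zeta>)"
  note c = frame_chart_at_frame_of[OF M, of k u] and g = GL_chart_at[OF h]
  note e = prod_chart_at[OF c g]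
  have w: "w \<in> tangent_space ?PH (?q, h)" "w ?e = (\<xi>, \<zeta>)"
    unfolding w_def by (rule frame_GL_frame.source.coord_tvec_tangent[OF e], rule frame_GL_frame.source.coord_tvec_same[OF e])
  note p = frame_GL.tangent_map_projections[OF c g w(1)]
  note q = frame_of_in_frame_bundle[OF M, of k u]
  have fst_w: "tangent_map ?PH frame_atlas fst (?q, h) w = coord_tvec frame_atlas ?c ?q \<xi>"
    by (rule frame.coord_tvec_eqI[OF p(1) c]) (simp add: p(2) w(2))
  have snd_w: "GL_acs h (tangent_map ?PH GL_atlas snd (?q, h) w)
      = (\<lambda>d. map_matrix ((*) \<i>) (tangent_map ?PH GL_atlas snd (?q, h) w d))"
    unfolding GL_acs_def by (rule GL.chart_acs_apply[OF charts_at_carrier[OF g] p(3)])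
  have Jw: "J ?q (tangent_map ?PH frame_atlas fst (?q, h) w) \<in> tangent_space frame_atlas ?q"
    by (rule complexion_tangent[OF q p(1)])
  have iw: "GL_acs h (tangent_map ?PH GL_atlas snd (?q, h) w) \<in> tangent_space GL_atlas h"
    unfolding snd_w by (rule GL.tangent_I[OF p(3)])
  note K = frame_GL.product_acs_chart[where J = J and L = GL_acs, OF c g w(1) Jw iw]
  have Ke: "?K w ?e = (in_frame_chart J k (u, M) \<xi>, map_matrix ((*) \<i>) \<zeta>)"
    unfolding K(2) snd_w p(4) fst_w by (simp add: in_frame_chart_def w(2))
  note d = frame_right_action_local_derivative[OF M h, of k u]
  have "(?q, h) \<in> carrier ?PH" using e by (rule charts_at_carrier)
  then have "tangent_map ?PH frame_atlas frame_right_action (?q, h) (?K w)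
      = J (frame_right_action (?q, h)) (tangent_map ?PH frame_atlas frame_right_action (?q, h) w)"
    using J w(1) unfolding complexion_def almost_holomorphic_def by blast
  then have "?D (?K w ?e)
      = J (frame_right_action (?q, h)) (tangent_map ?PH frame_atlas frame_right_action (?q, h) w) ?c"
    using frame_GL_frame.tangent_map_chart[OF d K(1)] by simp
  then show ?thesis
    unfolding frame_GL_frame.tangent_map_eq_coord_tvec[OF d w(1)] w(2) Ke frame_of_right_action
    by (simp add: in_frame_chart_def)
qed

text \<open>The vertical vector \<open>Z\<close> at \<open>M\<close> is the velocity \<open>M ** \<zeta>\<close> of the right action at the unit matrix, with
  \<open>\<zeta> = inverse M ** Z\<close>.\<close>

lemma in_frame_chart_vertical:
  assumes M: "invertible M"
  shows "in_frame_chart J k (u, M) (0, Z) = (0, map_matrix ((*) \<i>) Z)"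
proof -
  obtain N where N: "M ** N = mat 1" using M unfolding invertible_def by blast
  have zero: "in_frame_chart J k (u, M) 0 = 0"
    using in_frame_chart_add[OF M, of k u 0 0] by simp
  have "M ** map_matrix ((*) \<i>) (N ** Z) = map_matrix ((*) \<i>) (M ** (N ** Z))"
    by (simp add: vec_eq_iff matrix_matrix_mult_def sum_distrib_left algebra_simps)
  moreover have "M ** (N ** Z) = Z" by (simp add: matrix_mul_assoc N)
  moreover have "invertible (mat 1 :: complex ^ 'n ^ 'n)"
    unfolding invertible_def by (intro exI[of _ "mat 1"]) simp
  ultimately show ?thesis
    using in_frame_chart_right_action[OF M, of "mat 1" k u 0 "N ** Z"] by (simp add: zero)
qed

lemma in_frame_chart_left_action:
  assumes inv: "G_invariant J" and g: "g \<in> SU" and u: "u \<in> cp_domain g k l" and M: "invertible M"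
    and D: "(frame_map g k l has_derivative D) (at (u, M))"
  shows "in_frame_chart J l (frame_map g k l (u, M)) (D \<xi>) = D (in_frame_chart J k (u, M) \<xi>)"
proof -
  let ?q = "frame_of k (u, M)" and ?c = "frame_chart (cp_chart k)" and ?d = "frame_chart (cp_chart l)"
  let ?v = "coord_tvec frame_atlas ?c ?q \<xi>"
  note c = frame_chart_at_frame_of[OF M, of k u]
  note T = frame.coord_tvec_tangent[OF c, of \<xi>]
  note q = frame_of_in_frame_bundle[OF M, of k u]
  note d = frame_left_action_local_derivative[OF SU_invertible[OF g] u M D]
  have "tangent_map frame_atlas frame_atlas (frame_left_action g) ?q (J ?q ?v) =
      J (frame_left_action g ?q) (tangent_map frame_atlas frame_atlas (frame_left_action g) ?q ?v)"
    using inv g q T unfolding G_invariant_def by blast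
  then have "D (J ?q ?v ?c)
      = J (frame_left_action g ?q) (tangent_map frame_atlas frame_atlas (frame_left_action g) ?q ?v) ?d"
    using frame_frame.tangent_map_chart[OF d complexion_tangent[OF q T]] by simp
  then show ?thesis
    unfolding frame_frame.tangent_map_eq_coord_tvec[OF d T] frame_left_action_frame_of[OF u]
      frame.coord_tvec_same[OF c]
    by (simp add: in_frame_chart_def)
qed

end

lemma uminus_mat_1_mult: "(- mat 1) ** Z = - Z" "Z ** (- mat 1) = - Z"
  for Z :: "complex ^ 'n ^ 'n"
proof -
  have "(- A) ** B = - (A ** B)" "A ** (- B) = - (A ** B)" for A B :: "complex ^ 'n ^ 'n"
    by (simp_all add: vec_eq_iff matrix_matrix_mult_def sum_negf)
  then show "(- mat 1) ** Z = - Z" "Z ** (- mat 1) = - Z" by simp_all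
qed

lemma uminus_mat_1_mult_vec: "(- mat 1) *v v = - v" for v :: "complex ^ 'n"
  by (simp add: vec_eq_iff matrix_vector_mult_def mat_def sum_negf if_distrib[of "\<lambda>x. x * _"]
      cong: if_cong)

text \<open>The unitary reflection \<open>s\<close> that is \<open>1\<close> on the line of \<open>w\<close> and \<open>-1\<close> on its orthogonal complement fixes the
  line and acts by \<open>-1\<close> on the tangent space, which consists of the linear maps from the line to the
  complement. Its determinant is removed by a scalar \<open>a\<close> of modulus one, which does not affect the action
  on projective space.\<close>

lemma point_reflection:
  fixes u :: "complex ^ ('n::finite)" and k :: "'n option"
  obtains g where "g \<in> SU" "u \<in> cp_domain g k k" "cp_map g k k u = u" "cp_jac g k k u = - mat 1"
proof -
  define w where "w = homogeneous k u"
  \<comment> \<open>the Hermitian product with \<open>w\<close>, so that \<open>s\<close> is twice the orthogonal projection to \<open>w\<close> minus the identity\<close>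
  define b where "b y = (\<Sum>j\<in>UNIV. cnj (w $ j) * y $ j)" for y :: "complex ^ ('n option)"
  define s :: "complex ^ ('n option) ^ ('n option)"
    where "s = (\<chi> i j. 2 / b w * w $ i * cnj (w $ j) - (if i = j then 1 else 0))"
  have wk: "w $ k = 1" by (simp add: w_def homogeneous_nth)
  have bw_real: "b w = of_real (\<Sum>j\<in>UNIV. (cmod (w $ j))\<^sup>2)"
    by (simp add: b_def mult.commute[of "cnj _"] complex_norm_square[symmetric])
  have "0 < (\<Sum>j\<in>UNIV. (cmod (w $ j))\<^sup>2)"
    by (rule sum_pos2[of _ k]) (simp_all add: wk)
  then have bw: "b w \<noteq> 0" unfolding bw_real of_real_eq_0_iff by simp
  have s_mult: "s *v y = (2 * b y / b w) *s w - y" for y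
    unfolding vec_eq_iff
  proof
    fix i
    have "(s *v y) $ i = (\<Sum>j\<in>UNIV. 2 / b w * w $ i * (cnj (w $ j) * y $ j))
        - (\<Sum>j\<in>UNIV. (if i = j then 1 else 0) * y $ j)"
      unfolding sum_subtractf[symmetric] by (simp add: s_def matrix_vector_mult_def algebra_simps)
    also have "(\<Sum>j\<in>UNIV. 2 / b w * w $ i * (cnj (w $ j) * y $ j)) = 2 / b w * w $ i * b y"
      unfolding b_def[of y] by (rule sum_distrib_left[symmetric])
    finally show "(s *v y) $ i = ((2 * b y / b w) *s w - y) $ i"
      by (simp add: if_distrib[of "\<lambda>x. x * _"] cong: if_cong)
  qed
  have b_linear: "b (a *s y - z) = a * b y - b z" for a y z
    by (simp add: b_def algebra_simps sum_subtractf sum_distrib_left)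
  have s_twice: "s *v (s *v y) = y" for y
  proof -
    have "b (s *v y) = b y" by (simp add: s_mult b_linear bw)
    then show ?thesis by (simp add: s_mult[of "s *v y"]) (simp add: s_mult)
  qed
  have s_s: "s ** s = mat 1" by (simp add: matrix_eq matrix_vector_mul_assoc[symmetric] s_twice)
  have s_herm: "transpose (map_matrix cnj s) = s"
  proof -
    have "cnj (b w) = b w" unfolding bw_real by simp
    then show ?thesis by (auto simp: vec_eq_iff transpose_def s_def)
  qed
  have det2: "det s * det s = 1" using det_mul[of s s] by (simp add: s_s)
  \<comment> \<open>an \<open>m\<close>-th root \<open>a\<close> of \<open>det s\<close> suffices since \<open>det s\<close> is its own inverse\<close>
  define m where "m = CARD('n option)"
  define a where "a = exp (Ln (det s) / of_nat m)"
  have m: "m \<noteq> 0" by (simp add: m_def)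
  have "det s \<noteq> 0" using det2 by auto
  then have a_m: "a ^ m = det s"
    using m by (simp add: a_def exp_of_nat_mult[symmetric])
  have "cmod (det s) * cmod (det s) = 1" using det2 by (metis norm_mult norm_one)
  then have "cmod (det s) = 1" by (simp add: square_eq_1_iff) (metis abs_norm_cancel abs_minus_cancel abs_one)
  then have "cmod a ^ m = 1" using a_m by (metis norm_power)
  from power_eq_1_iff[OF this] have "cmod a = 1" using m by simp
  then have a_a: "cnj a * a = 1" using complex_norm_square[of a] by (simp add: mult.commute)
  then have a: "a \<noteq> 0" by auto
  define g where "g = (\<chi> i. a *s (s $ i))"
  have g_mult: "g *v y = a *s (s *v y)" for y
    by (simp add: g_def vec_eq_iff matrix_vector_mult_def sum_distrib_left algebra_simps)
  have "transpose (map_matrix cnj g) ** g = mat 1"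
  proof -
    have star: "transpose (map_matrix cnj g) *v y = cnj a *s (transpose (map_matrix cnj s) *v y)" for y
      by (simp add: g_def vec_eq_iff matrix_vector_mult_def transpose_def sum_distrib_left algebra_simps del: transpose_matrix_vector)
    have "transpose (map_matrix cnj g) *v (g *v y) = (cnj a * a) *s (s *v (s *v y))" for y
      unfolding star s_herm g_mult vector_scalar_commute vector_smult_assoc
      by (simp only: mult.commute)
    then have "transpose (map_matrix cnj g) *v (g *v y) = y" for y by (simp add: a_a s_twice)
    then show ?thesis by (simp add: matrix_eq matrix_vector_mul_assoc[symmetric] del: transpose_matrix_vector)
  qed
  moreover have "det g = 1"
  proof -
    have "det g = (\<Prod>i\<in>(UNIV :: 'n option set). a) * det (\<chi> i. s $ i)"
      unfolding g_def by (rule det_rows_mul)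
    also have "\<dots> = a ^ m * det s" by (simp only: prod_constant m_def vec_lambda_eta)
    finally show ?thesis by (simp only: a_m det2)
  qed
  ultimately have g: "g \<in> SU" by (simp add: SU_def)
  have gw: "g *v w = a *s w"
    by (simp add: g_mult s_mult bw) (simp add: vec_eq_iff)
  have dom: "u \<in> cp_domain g k k" using gw a wk by (simp add: cp_domain_def w_def)
  have map: "cp_map g k k u = u"
    using gw a wk by (simp add: cp_map_def w_def[symmetric] vec_eq_iff) (simp add: w_def homogeneous_nth)
  have "cp_deriv g k k u v = - v" for v
    unfolding cp_deriv_def w_def[symmetric] gw g_mult s_mult vec_eq_iff
    using a bw by (simp add: wk hyperplane_emb_nth) (simp add: field_simps)
  then have "cp_jac g k k u *v v = (- mat 1) *v v" for v
    by (simp only: cp_jac_mult uminus_mat_1_mult_vec)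
  then have "cp_jac g k k u = - mat 1" by (simp add: matrix_eq)
  then show thesis using that g dom map by blast
qed

text \<open>The derivative \<open>D\<close> of the point reflection and that of the right action of \<open>-1\<close> both map tangent vectors
  at \<open>(u, M)\<close> to tangent vectors at \<open>(u, - M)\<close>. Their sum maps \<open>\<xi>\<close> to a vertical vector, on which \<open>J\<close> is known,
  and it is \<open>-2\<close> on the vertical vector \<open>Z\<close> by which \<open>J\<close> could deviate from the multiplication by \<open>\<i>\<close>.\<close>

lemma invariant_complexion_in_frame_chart:
  assumes J: "complexion J" and inv: "G_invariant J" and M: "invertible M"
  shows "in_frame_chart J k (u, M) \<xi> = frame_I \<xi>"
proof -
  obtain g where g: "g \<in> SU" and u: "u \<in> cp_domain g k k" and fix_u: "cp_map g k k u = u"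
    and jac: "cp_jac g k k u = - mat 1" by (rule point_reflection)
  have "(u, M) \<in> cp_domain g k k \<times> GL" using u M by simp
  from complex_C2_imp_has_derivative[OF complex_C2_frame_map this]
  obtain D where D: "(frame_map g k k has_derivative D) (at (u, M))"
    and D_I: "\<And>v. D (frame_I v) = frame_I (D v)" by metis
  have D_fst: "fst (D \<eta>) = - fst \<eta>" for \<eta>
    unfolding frame_map_derivative(1)[OF u D] jac uminus_mat_1_mult_vec ..
  have D_vert: "D (0, Z) = (0, - Z)" for Z
    unfolding frame_map_derivative(2)[OF u D] jac uminus_mat_1_mult ..
  have D_add: "D (\<eta> + \<theta>) = D \<eta> + D \<theta>" for \<eta> \<theta>
    using has_derivative_linear[OF D] by (rule linear_add)
  have moved: "frame_map g k k (u, M) = (u, - M)"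
    by (simp add: frame_map_def fix_u jac uminus_mat_1_mult)
  have minus: "invertible (- mat 1 :: complex ^ 'n ^ 'n)"
    unfolding invertible_def by (intro exI[of _ "- mat 1"]) (simp add: uminus_mat_1_mult)
  have M': "invertible (- M)" using invertible_mult[OF M minus] by (simp add: uminus_mat_1_mult)
  let ?j = "in_frame_chart J k (u, M)" and ?j' = "in_frame_chart J k (u, - M)"
  define Z where "Z = snd (?j \<xi>) - map_matrix ((*) \<i>) (snd \<xi>)"
  have j: "?j \<xi> = frame_I \<xi> + (0, Z)"
    using in_frame_chart_fst[OF J M, of k u \<xi>] by (simp add: prod_eq_iff Z_def)
  have left: "?j' (D \<xi>) = D (?j \<xi>)"
    using in_frame_chart_left_action[OF J inv g u M D, of \<xi>] by (simp add: moved)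
  have "M ** 0 = 0" by (simp add: vec_eq_iff matrix_matrix_mult_def)
  then have right: "?j' (fst \<xi>, - snd \<xi>) = (fst (?j \<xi>), - snd (?j \<xi>))"
    using in_frame_chart_right_action[OF J M minus, of k u \<xi> 0]
    by (simp add: uminus_mat_1_mult linear_0[OF linear_map_matrix_mult])
  \<comment> \<open>the vertical vector to which the sum of the two differentials maps \<open>\<xi>\<close>\<close>
  define Y where "Y = snd (D \<xi>) - snd \<xi>"
  have vertical: "D \<xi> + (fst \<xi>, - snd \<xi>) = (0, Y)" by (simp add: prod_eq_iff D_fst Y_def)
  have "D (?j \<xi>) + (fst (?j \<xi>), - snd (?j \<xi>)) = ?j' (D \<xi> + (fst \<xi>, - snd \<xi>))"
    by (simp only: in_frame_chart_add[OF J M'] left right)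
  also have "\<dots> = frame_I (D \<xi> + (fst \<xi>, - snd \<xi>))"
    unfolding vertical in_frame_chart_vertical[OF J M'] by (simp add: prod_eq_iff vec_eq_iff)
  also have "\<dots> = D (frame_I \<xi>) + (fst (frame_I \<xi>), - snd (frame_I \<xi>))"
    by (simp add: linear_add[OF linear_frame_I] D_I) (simp add: prod_eq_iff vec_eq_iff)
  finally have "D (0, Z) + (0, - Z) = 0"
    unfolding j D_add by (simp add: prod_eq_iff)
  then have "2 *\<^sub>R Z = 0" by (simp add: D_vert zero_prod_def scaleR_2)
  then have "Z = 0" by simp
  then show ?thesis by (simp add: j zero_prod_def[symmetric])
qed

lemma invariant_complexion_unique:
  fixes J :: "('n::finite frame, 'n frame_model) endo"
  assumes J: "complexion J" and inv: "G_invariant J"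
  shows "J = frame_acs"
proof (rule PiE_ext)
  have acs: "almost_complex_structure frame_atlas J"
    "almost_complex_structure frame_atlas (frame_acs :: ('n frame, 'n frame_model) endo)"
    using J complexion_frame_acs unfolding complexion_def by blast+
  show J_mem: "J \<in> (\<Pi>\<^sub>E x\<in>carrier frame_atlas. tangent_space frame_atlas x \<rightarrow>\<^sub>E tangent_space frame_atlas x)"
    using acs(1) unfolding almost_complex_structure_def by (rule conjunct1)
  show K_mem: "(frame_acs :: ('n frame, 'n frame_model) endo) \<in> (\<Pi>\<^sub>E x\<in>carrier frame_atlas. tangent_space frame_atlas x \<rightarrow>\<^sub>E tangent_space frame_atlas x)"
    using acs(2) unfolding almost_complex_structure_def by (rule conjunct1)
  fix q :: "'n frame" assume q: "q \<in> carrier frame_atlas"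
  show "J q = frame_acs q"
  proof (rule PiE_ext[OF PiE_mem[OF J_mem q] PiE_mem[OF K_mem q]])
    fix v assume v: "v \<in> tangent_space frame_atlas q"
    have "q \<in> frame_bundle" using q by (simp add: carrier_frame_atlas)
    then obtain k u M where M: "invertible M" "q = frame_of k (u, M)" by (rule frame_bundle_exhaust)
    have c: "frame_chart (cp_chart k) \<in> charts_at frame_atlas q"
      unfolding M(2) by (rule frame_chart_at_frame_of[OF M(1)])
    note v_eq = frame.coord_tvec_eqI[OF v c refl]
    show "J q v = frame_acs q v"
    proof (rule frame.tangent_eqI[OF PiE_mem[OF PiE_mem[OF J_mem q] v] PiE_mem[OF PiE_mem[OF K_mem q] v] c])
      show "J q v (frame_chart (cp_chart k)) = frame_acs q v (frame_chart (cp_chart k))"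
        using invariant_complexion_in_frame_chart[OF J inv M(1), of k u "v (frame_chart (cp_chart k))"]
        unfolding in_frame_chart_def M(2)[symmetric] v_eq[symmetric]
        by (simp add: frame_acs_def frame.chart_acs_apply[OF q v])
    qed
  qed
qed

theorem proposition6p6:
  shows "\<exists>!J :: (('n::finite) frame, 'n frame_model) endo.
           complexion J \<and> G_invariant J \<and> integrable_acs frame_atlas J"
proof (rule ex1I[of _ frame_acs])
  show "complexion (frame_acs :: ('n frame, 'n frame_model) endo) \<and> G_invariant (frame_acs :: ('n frame, 'n frame_model) endo)
      \<and> integrable_acs frame_atlas (frame_acs :: ('n frame, 'n frame_model) endo)"
    using complexion_frame_acs G_invariant_frame_acs frame.chart_acs_integrable
    unfolding frame_acs_def by blast
next
  fix J :: "('n frame, 'n frame_model) endo"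
  assume "complexion J \<and> G_invariant J \<and> integrable_acs frame_atlas J"
  then show "J = frame_acs" using invariant_complexion_unique by blast
qed

end
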